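(* Let $q\in\mathbb{R}$ and $c\in L^2((0,1))$, and let $c_n=\langle c,\phi_n\rangle$ for $n\ge 0$. Suppose that $N>0$ is an integer with $(N+1)^2\pi^2>q$, such that $q\neq (n^2+m^2)\pi^2$ for all $n,m\in\{0,\dots,N\}$ with $n\neq m$, and such that $c_n\neq 0$ for all $n=0,\dots,N$. Let $L=(L_0,\dots,L_N)^{\top}\in\mathbb{R}^{N+1}$ and let $R,\omega>0$ be constants such that $|\exp((A_N+LC_N)t)|\le R\exp(-\omega t)$ for all $t\ge 0$. Let $r\in\mathbb{R}$ and set $$Z=R\,|L|\,\left|C_N(A_N+rI_N)\right|,$$ where $I_N\in\mathbb{R}^{(N+1)\times(N+1)}$ is the identity matrix. Then for every $T>0$ with $$Z\exp\left(\max(0,-r)T\right)\int_0^T\exp(rs)\,ds<\omega$$ there exist constants $\sigma,\gamma>0$, $M\ge 1$ for which the following property holds. For every $u_0,\hat u_0\in X$, every $f\in C^1(\mathbb{R}_+;L^2((0,1)))$, every $\xi\in L^\infty(\mathbb{R}_+)$ and every sequence $\{t_j\ge 0: j=0,1,\dots\}$ with $t_0=0$, $t_j<t_{j+1}\le t_j+T$ for all $j=0,1,\dots$ and $\lim_{j\to+\infty}t_j=+\infty$, the unique solution $(u,\hat u,w)$ of the plant--observer system described in the context with initial condition $u[0]=u_0$, $\hat u[0]=\hat u_0$ satisfies, for all $t\ge 0$: $$\|\hat u[t]-u[t]\|\le M\exp(-\sigma t)\|\hat u_0-u_0\|+\gamma\sup_{0\le s\le t}|\xi(s)|,$$ $$\|\hat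 u_{xx}[t]-u_{xx}[t]\|\le N^2\pi^2\exp(-\sigma t)(M-1)\|\hat u_0-u_0\|+\exp(-\sigma t)\|\hat u_0''-u_0''\|+\gamma N^2\pi^2\sup_{0\le s\le t}|\xi(s)|,$$ $$\|\hat u_{xxxx}[t]-u_{xxxx}[t]\|\le N^4\pi^4\exp(-\sigma t)(M-1)\|\hat u_0-u_0\|+\exp(-\sigma t)\|\hat u_0^{(4)}-u_0^{(4)}\|+\gamma N^4\pi^4\sup_{0\le s\le t}|\xi(s)|.$$
   Context: All spaces are real. $\mathbb{R}_+=[0,+\infty)$. $\|\cdot\|$ and $\langle\cdot,\cdot\rangle$ are the norm and inner product of $L^2((0,1))$; $|\cdot|$ is the Euclidean norm for vectors and the induced norm for matrices. For a function $u$ of $(t,x)$, $u[t]$ denotes the profile $x\mapsto u(t,x)$; $u_t$ is the derivative of $t\mapsto u[t]$ as an $L^2((0,1))$-valued map; subscripts $x$ denote spatial derivatives. The noise $\xi\in L^\infty(\mathbb{R}_+)$ is regarded as a function with a value at every time (its values $\xi(t_j)$ are used), and $\sup$ is the pointwise supremum. Eigenfunctions and eigenvalues: $\phi_0(x)\equiv 1$, $\phi_n(x)=\sqrt2\cos(n\pi x)$ for $n\ge1$ (an orthonormal basis of $L^2((0,1))$); $\lambda_n=n^2\pi^2$ and $\mu_n=-\lambda_n(\lambda_n-q)$ for $n\ge 0$. Matrices: $A_N=\mathrm{diag}(\mu_0,\mu_1,\dots,\mu_N)\in\mathbb{R}^{(N+1)\times(N+1)}$ and $C_N=[c_0\ c_1\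 \cdots\ c_N]\in\mathbb{R}^{1\times(N+1)}$. Projection: $G:L^2((0,1))\to L^2((0,1))$, $Gu=\sum_{n=0}^N\langle u,\phi_n\rangle\phi_n$; $I$ is the identity on $L^2((0,1))$. State space: $X=\{u\in H^4((0,1)): u'(0)=u'''(0)=u'(1)=u'''(1)=0\}$. Plant--observer system with sampling times $0=t_0<t_1<\cdots$: Plant: $u_t=-u_{xxxx}-qu_{xx}+f$ for $t>0$, $x\in(0,1)$, with $u_x=u_{xxx}=0$ at $x=0$ and $x=1$, and output $y(t)=\langle c,u[t]\rangle+\xi(t)$. Observer: $\hat u_t=-\hat u_{xxxx}-q\hat u_{xx}+f+\left(\langle Gc,\hat u\rangle-w\right)\sum_{n=0}^N L_n\phi_n$ for $t>0$, $t\ne t_j$, with $\hat u_x=\hat u_{xxx}=0$ at $x=0$ and $x=1$. Inter-sample predictor: $w(t_j)=y(t_j)+\langle (G-I)c,\hat u[t_j]\rangle$ for $j=0,1,\dots$, and $\dot w=\sum_{n=0}^N\mu_nc_n\langle\phi_n,\hat u\rangle+\langle Gc,f\rangle-r\left(w-\langle Gc,\hat u\rangle\right)$ for $t\in[t_j,t_{j+1})$, $j=0,1,\dots$. Notion of solution: successively for $j=0,1,\dots$, given $u[t_j],\hat u[t_j]\in X$, one computes $w(t_j)$ from the reset formula (using $y(t_j)=\langle c,u[t_j]\rangle+\xi(t_j)$), and then $(u,\hat u,w)$ on $[t_j,t_{j+1}]$ is the classical solution, with values in $X\times X\times\mathbb{R}$, of the three evolution equations above viewed as an abstract linear evolution equation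 in $L^2((0,1))\times L^2((0,1))\times\mathbb{R}$ with initial value $(u[t_j],\hat u[t_j],w(t_j))$ at $t_j$ (the value of $w$ is then reset at $t_{j+1}$). For all data as in the claim there is a unique such solution, with $u\in C^1(\mathbb{R}_+;L^2((0,1)))$, $\hat u\in C^0(\mathbb{R}_+;L^2((0,1)))\cap C^1(\mathbb{R}_+\setminus\{t_j:j=0,1,\dots\};L^2((0,1)))$ and $u[t],\hat u[t]\in X$ for all $t\ge0$. *)

theory Defs
  imports "HOL-Analysis.Analysis" "Jordan_Normal_Form.Matrix"
begin

hide_const (open) Finite_Cartesian_Product.vec
hide_type (open) Finite_Cartesian_Product.vec

abbreviation unit_measure :: "real measure" where
  "unit_measure \<equiv> lebesgue_on {0<..<1}"

definition square_integrable :: "(real \<Rightarrow> real) \<Rightarrow> bool" where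
  "square_integrable f \<longleftrightarrow>
     f \<in> borel_measurable unit_measure \<and> integrable unit_measure (\<lambda>x. (f x)\<^sup>2)"

definition L2_rel :: "(real \<Rightarrow> real) \<Rightarrow> (real \<Rightarrow> real) \<Rightarrow> bool" where
  "L2_rel f g \<longleftrightarrow>
     square_integrable f \<and> square_integrable g \<and> (AE x in unit_measure. f x = g x)"

lemma square_integrable_bounded:
  assumes "f \<in> borel_measurable unit_measure" "\<And>x. \<bar>f x\<bar> \<le> B"
  shows "square_integrable f"
proof -
  have fin: "finite_measure unit_measure"
    by (rule finite_measure_lebesgue_on) (simp add: lmeasurable_interval)
  have "integrable unit_measure (\<lambda>x. (f x)\<^sup>2)"
  proof (rule finite_measure.integrable_const_bound[OF fin, where B = "B\<^sup>2"])
    show "AE x in unit_measure. norm ((f x)\<^sup>2) \<le> B\<^sup>2"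
      using power_mono[OF assms(2) abs_ge_zero, of _ 2] by (intro AE_I2) simp
  qed (use assms in measurable)
  with assms show ?thesis by (simp add: square_integrable_def)
qed

lemma integrable_mult_square_integrable:
  assumes "square_integrable f" "square_integrable g"
  shows "integrable unit_measure (\<lambda>x. f x * g x)"
proof (rule Bochner_Integration.integrable_bound)
  show "integrable unit_measure (\<lambda>x. (f x)\<^sup>2 + (g x)\<^sup>2)"
    using assms by (simp add: square_integrable_def)
  show "(\<lambda>x. f x * g x) \<in> borel_measurable unit_measure"
    using assms by (auto simp: square_integrable_def)
  have "\<bar>a * b\<bar> \<le> a\<^sup>2 + b\<^sup>2" for a b :: real
  proof -
    have "2 * \<bar>a * b\<bar> \<le> a\<^sup>2 + b\<^sup>2"
      using sum_squares_bound[of "\<bar>a\<bar>" "\<bar>b\<bar>"] by (simp add: abs_mult)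
    then show ?thesis by linarith
  qed
  then show "AE x in unit_measure. norm (f x * g x) \<le> norm ((f x)\<^sup>2 + (g x)\<^sup>2)"
    by (auto intro!: AE_I2)
qed

lemma square_integrable_add:
  assumes "square_integrable f" "square_integrable g"
  shows "square_integrable (\<lambda>x. f x + g x)"
proof -
  have "integrable unit_measure (\<lambda>x. (f x)\<^sup>2 + (g x)\<^sup>2 + 2 * (f x * g x))"
    using assms integrable_mult_square_integrable[OF assms]
    by (auto simp: square_integrable_def)
  then show ?thesis
    using assms by (auto simp: square_integrable_def power2_sum mult.assoc)
qed

lemma square_integrable_scale:
  assumes "square_integrable f"
  shows "square_integrable (\<lambda>x. a * f x)"
  using assms by (auto simp: square_integrable_def power_mult_distrib)

lemma part_equivp_L2_rel: "part_equivp L2_rel"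
proof (rule part_equivpI)
  show "\<exists>f. L2_rel f f"
    by (rule exI[of _ "\<lambda>_. 0"]) (auto simp: L2_rel_def square_integrable_def)
  show "symp L2_rel"
    by (auto simp: symp_def L2_rel_def elim!: eventually_mono)
  show "transp L2_rel"
  proof (rule transpI)
    fix f g h assume "L2_rel f g" "L2_rel g h"
    moreover from this have "AE x in unit_measure. f x = h x"
      unfolding L2_rel_def by (auto elim: eventually_elim2)
    ultimately show "L2_rel f h" by (simp add: L2_rel_def)
  qed
qed

quotient_type L2 = "real \<Rightarrow> real" / partial: L2_rel
  morphisms rep_L2 to_L2
  by (rule part_equivp_L2_rel)

instantiation L2 :: real_inner
begin

lift_definition zero_L2 :: L2 is "\<lambda>_. 0"
  by (simp add: L2_rel_def square_integrable_def)

lift_definition plus_L2 :: "L2 \<Rightarrow> L2 \<Rightarrow> L2" is "\<lambda>f g x. f x + g x"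
  by (auto simp: L2_rel_def intro: square_integrable_add)

lift_definition scaleR_L2 :: "real \<Rightarrow> L2 \<Rightarrow> L2" is "\<lambda>a f x. a * f x"
  by (auto simp: L2_rel_def intro: square_integrable_scale)

lift_definition uminus_L2 :: "L2 \<Rightarrow> L2" is "\<lambda>f x. - f x"
  by (auto simp: L2_rel_def square_integrable_def)

definition minus_L2 :: "L2 \<Rightarrow> L2 \<Rightarrow> L2" where
  "minus_L2 u v = u + (- v)"

lift_definition inner_L2 :: "L2 \<Rightarrow> L2 \<Rightarrow> real"
  is "\<lambda>f g. integral\<^sup>L unit_measure (\<lambda>x. f x * g x)"
  by (rule Bochner_Integration.integral_cong_AE)
    (auto simp: L2_rel_def square_integrable_def)

definition norm_L2 :: "L2 \<Rightarrow> real" where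
  "norm_L2 u = sqrt (inner u u)"

definition sgn_L2 :: "L2 \<Rightarrow> L2" where
  "sgn_L2 u = scaleR (inverse (norm u)) u"

definition dist_L2 :: "L2 \<Rightarrow> L2 \<Rightarrow> real" where
  "dist_L2 u v = norm (u - v)"

definition uniformity_L2 :: "(L2 \<times> L2) filter" where
  "uniformity_L2 = (INF e\<in>{0<..}. principal {(u, v). dist u v < e})"

definition open_L2 :: "L2 set \<Rightarrow> bool" where
  "open_L2 U \<longleftrightarrow> (\<forall>u\<in>U. \<forall>\<^sub>F (u', v) in uniformity. u' = u \<longrightarrow> v \<in> U)"

instance
proof
  fix u v w :: L2 and a b :: real and U :: "L2 set"
  show "u + v + w = u + (v + w)"
    by transfer (auto simp: L2_rel_def add.assoc intro!: square_integrable_add)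
  show "u + v = v + u"
    by transfer (auto simp: L2_rel_def add.commute intro!: square_integrable_add)
  show "0 + u = u"
    by transfer (auto simp: L2_rel_def)
  show "- u + u = 0"
    by transfer (auto simp: L2_rel_def square_integrable_def)
  show "u - v = u + - v"
    by (rule minus_L2_def)
  show "a *\<^sub>R (u + v) = a *\<^sub>R u + a *\<^sub>R v"
    by transfer (auto simp: L2_rel_def distrib_left
        intro!: square_integrable_add square_integrable_scale)
  show "(a + b) *\<^sub>R u = a *\<^sub>R u + b *\<^sub>R u"
    by transfer (auto simp: L2_rel_def distrib_right
        intro!: square_integrable_add square_integrable_scale)
  show "a *\<^sub>R b *\<^sub>R u = (a * b) *\<^sub>R u"
    by transfer (auto simp: L2_rel_def mult.assoc intro!: square_integrable_scale)
  show "1 *\<^sub>R u = u"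
    by transfer (auto simp: L2_rel_def)
  show "inner u v = inner v u"
    by transfer (simp add: mult.commute)
  show "inner (u + v) w = inner u w + inner v w"
    by transfer (simp add: L2_rel_def distrib_right integrable_mult_square_integrable)
  show "inner (a *\<^sub>R u) v = a * inner u v"
    by transfer (simp add: mult.assoc)
  show "0 \<le> inner u u"
    by transfer simp
  show "inner u u = 0 \<longleftrightarrow> u = 0"
  proof transfer
    fix f assume "L2_rel f f"
    then have f: "square_integrable f" by (simp add: L2_rel_def)
    then have i: "integrable unit_measure (\<lambda>x. f x * f x)"
      by (rule integrable_mult_square_integrable) (rule f)
    show "integral\<^sup>L unit_measure (\<lambda>x. f x * f x) = 0 \<longleftrightarrow> L2_rel f (\<lambda>_. 0)"
      using f by (subst integral_nonneg_eq_0_iff_AE[OF i])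
        (auto simp: L2_rel_def square_integrable_def)
  qed
qed (simp_all only: norm_L2_def sgn_L2_def dist_L2_def uniformity_L2_def open_L2_def)

end

lift_definition phi :: "nat \<Rightarrow> L2"
  is "\<lambda>n x. if n = 0 then 1 else sqrt 2 * cos (real n * pi * x)"
proof -
  fix n :: nat
  let ?f = "\<lambda>x::real. if n = 0 then 1 else sqrt 2 * cos (real n * pi * x)"
  have "continuous_on {0<..<1} ?f"
    by (cases "n = 0") (auto intro!: continuous_intros)
  then have "?f \<in> borel_measurable unit_measure"
    by (intro continuous_imp_measurable_on_sets_lebesgue) auto
  moreover have "\<bar>?f x\<bar> \<le> sqrt 2" for x
    by (auto simp: abs_mult intro!: mult_left_le)
  ultimately show "L2_rel ?f ?f"
    by (auto simp: L2_rel_def intro: square_integrable_bounded)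
qed

definition lam :: "nat \<Rightarrow> real" where
  "lam n = (real n)\<^sup>2 * pi\<^sup>2"

definition mu :: "real \<Rightarrow> nat \<Rightarrow> real" where
  "mu q n = - lam n * (lam n - q)"

definition coef :: "L2 \<Rightarrow> nat \<Rightarrow> real" where
  "coef u n = inner u (phi n)"

definition G_proj :: "nat \<Rightarrow> L2 \<Rightarrow> L2" where
  "G_proj N u = (\<Sum>n\<le>N. coef u n *\<^sub>R phi n)"

text \<open>
  Weak derivatives are tested, as in Brezis' book on Sobolev spaces, against continuously
  differentiable functions with compact support in the open unit interval. The map \<open>to_L2\<close> is
  only meaningful on square-integrable functions; it is only applied to continuous ones below.
\<close>

definition test_function :: "(real \<Rightarrow> real) \<Rightarrow> (real \<Rightarrow> real) \<Rightarrow> bool" where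
  "test_function p p' \<longleftrightarrow>
     (\<forall>x. (p has_real_derivative p' x) (at x)) \<and> continuous_on UNIV p' \<and>
     (\<exists>a b. 0 < a \<and> b < 1 \<and> (\<forall>x. x \<notin> {a..b} \<longrightarrow> p x = 0))"

definition weak_deriv :: "L2 \<Rightarrow> L2 \<Rightarrow> bool" where
  "weak_deriv u v \<longleftrightarrow>
     (\<forall>p p'. test_function p p' \<longrightarrow> inner u (to_L2 p') = - inner v (to_L2 p))"

definition Dx :: "L2 \<Rightarrow> L2" where
  "Dx u = (THE v. weak_deriv u v)"

fun Sobolev :: "nat \<Rightarrow> L2 set" where
  "Sobolev 0 = UNIV"
| "Sobolev (Suc k) = {u. (\<exists>v. weak_deriv u v) \<and> Dx u \<in> Sobolev k}"

text \<open>
  Boundary values are those of the continuous representative on the closed unit interval.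
\<close>

definition boundary_value :: "L2 \<Rightarrow> real \<Rightarrow> real \<Rightarrow> bool" where
  "boundary_value u a y \<longleftrightarrow> (\<exists>g. continuous_on {0..1} g \<and> u = to_L2 g \<and> g a = y)"

definition state_space :: "L2 set" where
  "state_space = {u \<in> Sobolev 4.
     boundary_value (Dx u) 0 0 \<and> boundary_value ((Dx ^^ 3) u) 0 0 \<and>
     boundary_value (Dx u) 1 0 \<and> boundary_value ((Dx ^^ 3) u) 1 0}"

definition vec_norm :: "real Matrix.vec \<Rightarrow> real" where
  "vec_norm v = L2_set (vec_index v) {..<dim_vec v}"

definition induced_norm :: "real mat \<Rightarrow> real" where
  "induced_norm A =
     Sup {vec_norm (A *\<^sub>v v) | v. v \<in> carrier_vec (dim_col A) \<and> vec_norm v \<le> 1}"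

definition mat_exp :: "real mat \<Rightarrow> real mat" where
  "mat_exp A =
     Matrix.mat (dim_row A) (dim_row A) (\<lambda>(i, j). \<Sum>k. (A ^\<^sub>m k) $$ (i, j) / fact k)"

definition A_mat :: "real \<Rightarrow> nat \<Rightarrow> real mat" where
  "A_mat q N = mat_diag (N + 1) (mu q)"

definition C_mat :: "L2 \<Rightarrow> nat \<Rightarrow> real mat" where
  "C_mat c N = Matrix.mat 1 (N + 1) (\<lambda>(i, n). coef c n)"

definition col_mat :: "real Matrix.vec \<Rightarrow> real mat" where
  "col_mat v = mat_of_cols (dim_vec v) [v]"

text \<open>One-sided derivatives are meant at boundary points of the set.\<close>

definition C1_on :: "real set \<Rightarrow> (real \<Rightarrow> 'a::real_normed_vector) \<Rightarrow> bool" where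
  "C1_on S g \<longleftrightarrow> (\<exists>g'. continuous_on S g' \<and>
     (\<forall>t\<in>S. (g has_vector_derivative g' t) (at t within S)))"

definition essentially_bounded :: "(real \<Rightarrow> real) \<Rightarrow> bool" where
  "essentially_bounded xi \<longleftrightarrow> xi \<in> borel_measurable (lebesgue_on {0..}) \<and>
     (\<exists>B. AE s in lebesgue_on {0..}. \<bar>xi s\<bar> \<le> B)"

definition sampling_times :: "real \<Rightarrow> (nat \<Rightarrow> real) \<Rightarrow> bool" where
  "sampling_times T ts \<longleftrightarrow> ts 0 = 0 \<and>
     (\<forall>j. ts j < ts (Suc j) \<and> ts (Suc j) \<le> ts j + T) \<and> filterlim ts at_top sequentially"

text \<open>
  \<open>u\<close> is the plant state, \<open>uh\<close> the observer state, \<open>w\<close> the inter-sample predictor and \<open>xi\<close> the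
  measurement noise: the sampled output at \<open>ts j\<close> is \<open>inner c (u (ts j)) + xi (ts j)\<close>. The boundary
  conditions are part of \<open>state_space\<close>. At \<open>ts j\<close> the function \<open>w\<close> takes the reset value and its
  derivative is the right one; its left limit there exists because of its differential equation.
\<close>

definition plant_observer_solution ::
  "real \<Rightarrow> L2 \<Rightarrow> nat \<Rightarrow> real Matrix.vec \<Rightarrow> real \<Rightarrow> (real \<Rightarrow> L2) \<Rightarrow> (real \<Rightarrow> real) \<Rightarrow>
   (nat \<Rightarrow> real) \<Rightarrow> (real \<Rightarrow> L2) \<Rightarrow> (real \<Rightarrow> L2) \<Rightarrow> (real \<Rightarrow> real) \<Rightarrow> bool" where
  "plant_observer_solution q c N L r f xi ts u uh w \<longleftrightarrow>
     C1_on {0..} u \<and>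
     continuous_on {0..} uh \<and> C1_on ({0..} - range ts) uh \<and>
     (\<forall>t\<ge>0. u t \<in> state_space \<and> uh t \<in> state_space) \<and>
     (\<forall>t>0. (u has_vector_derivative
        (- (Dx ^^ 4) (u t) - q *\<^sub>R (Dx ^^ 2) (u t) + f t)) (at t)) \<and>
     (\<forall>t>0. t \<notin> range ts \<longrightarrow> (uh has_vector_derivative
        (- (Dx ^^ 4) (uh t) - q *\<^sub>R (Dx ^^ 2) (uh t) + f t
          + (inner (G_proj N c) (uh t) - w t) *\<^sub>R (\<Sum>n\<le>N. vec_index L n *\<^sub>R phi n))) (at t)) \<and>
     (\<forall>j. w (ts j) = (inner c (u (ts j)) + xi (ts j)) + inner (G_proj N c - c) (uh (ts j))) \<and>
     (\<forall>j. \<forall>t\<in>{ts j..<ts (Suc j)}. (w has_real_derivative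
        ((\<Sum>n\<le>N. mu q n * coef c n * inner (phi n) (uh t)) + inner (G_proj N c) (f t)
          - r * (w t - inner (G_proj N c) (uh t)))) (at t within {ts j..<ts (Suc j)}))"

end

theory Submission
  imports Defs
begin

text \<open>
  The estimates hold because the observation error \<open>e = uh - u\<close> splits into modes, and because
  the loop between the low modes and the predictor has gain below one. Write \<open>e_n\<close> for the
  coefficients of \<open>e\<close> in the cosine basis, \<open>z = (e_0, \<dots>, e_N)\<close> and \<open>d = w - \<langle>Gc, u\<rangle>\<close>. The input \<open>f\<close>
  cancels in the equations for \<open>e\<close> and \<open>d\<close>, and the output injection acts on the first \<open>N + 1\<close> modes
  only. Hence \<open>e_n' = mu_n e_n\<close> for \<open>n > N\<close>, with rates bounded by \<open>mu_(N+1) < 0\<close>, while between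
  samples
    \<open>z' = (A + L C) z - L d\<close> and \<open>d' = C (A + r I) z - r d\<close>.
  At a sampling time \<open>d\<close> is reset to \<open>xi - \<langle>c - Gc, e\<rangle>\<close>: noise plus an inner product that sees only
  the decaying high modes.

  In norms weighted by \<open>exp (\<sigma> t)\<close>, variation of constants bounds \<open>z\<close> by \<open>R |L| / (\<omega> - \<sigma>)\<close> times
  the bound for \<open>d\<close> (\<open>exp_forcing_bound\<close>), and integration over one sampling interval bounds \<open>d\<close> by
  its reset value and a multiple of the bound for \<open>z\<close> (\<open>predictor_bound\<close>). For \<open>\<sigma> \<rightarrow> 0\<close> the product of
  the two gains tends to the left-hand side of the hypothesis on \<open>T\<close> divided by \<open>\<omega>\<close>, so it is
  below one for some \<open>\<sigma> > 0\<close>, and the loop closes (\<open>weighted_small_gain\<close>,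
  \<open>sampled_error_estimates\<close>).

  To return from coefficients to norms one needs that the cosines are complete
  (\<open>G_proj_tendsto\<close>). Completeness is proved by approximating measurable functions by continuous
  ones, and those by polynomials in \<open>cos (pi x)\<close>. For the derivatives one needs that \<open>Dx ^^ 2\<close> and
  \<open>Dx ^^ 4\<close> multiply the coefficients of a state by \<open>- lam n\<close> and \<open>(lam n)\<^sup>2\<close>
  (\<open>coef_Dx_state_space\<close>). A multiplier of the coefficients costs at most its maximum over
  \<open>n \<le> N\<close> on the low modes. On the high modes it is absorbed into the initial value, because it does
  not change the decay factor of any mode (\<open>norm_le_of_multiplier\<close>).
\<close>

section \<open>Classes of square-integrable functions\<close>

lemma square_integrable_bounded_on:
  assumes "f \<in> borel_measurable unit_measure" "\<And>x. x \<in> {0<..<1} \<Longrightarrow> \<bar>f x\<bar> \<le> B"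
  shows "square_integrable f"
proof -
  have fin: "finite_measure unit_measure"
    by (rule finite_measure_lebesgue_on) (simp add: lmeasurable_interval)
  have "integrable unit_measure (\<lambda>x. (f x)\<^sup>2)"
  proof (rule finite_measure.integrable_const_bound[OF fin, where B = "B\<^sup>2"])
    show "AE x in unit_measure. norm ((f x)\<^sup>2) \<le> B\<^sup>2"
      using power_mono[OF assms(2) abs_ge_zero, of _ 2] by (intro AE_I2) auto
  qed (use assms in measurable)
  with assms show ?thesis by (simp add: square_integrable_def)
qed

lemma square_integrable_continuous:
  assumes "continuous_on {0..1} g"
  shows "square_integrable g"
proof -
  have "compact (g ` {0..1})"
    using assms by (intro compact_continuous_image) auto
  then obtain B where "\<And>x. x \<in> {0..1} \<Longrightarrow> \<bar>g x\<bar> \<le> B"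
    by (metis compact_imp_bounded bounded_iff imageI real_norm_def)
  moreover have "g \<in> borel_measurable unit_measure"
    using assms
    by (intro continuous_imp_measurable_on_sets_lebesgue) (auto intro: continuous_on_subset)
  ultimately show ?thesis
    by (intro square_integrable_bounded_on[where B = B]) auto
qed

lemma square_integrable_diff:
  assumes "square_integrable f" "square_integrable g"
  shows "square_integrable (\<lambda>x. f x - g x)"
  using square_integrable_add[OF assms(1) square_integrable_scale[OF assms(2), of "-1"]] by simp

lemma L2_cases:
  obtains f where "square_integrable f" "u = to_L2 f"
  by (metis L2_rel_def Quotient3_L2 Quotient3_rep_reflp Quotient3_abs_rep)

lemma L2_rel_refl [simp]: "L2_rel f f \<longleftrightarrow> square_integrable f"
  by (simp add: L2_rel_def)

lemma to_L2_eq_iff: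
  assumes "square_integrable f" "square_integrable g"
  shows "to_L2 f = to_L2 g \<longleftrightarrow> (AE x in unit_measure. f x = g x)"
  using Quotient3_rel[OF Quotient3_L2, of f g] assms by (auto simp: L2_rel_def)

lemma to_L2_add:
  assumes "square_integrable f" "square_integrable g"
  shows "to_L2 (\<lambda>x. f x + g x) = to_L2 f + to_L2 g"
  using assms by (subst plus_L2.abs_eq) auto

lemma to_L2_scale:
  assumes "square_integrable f"
  shows "to_L2 (\<lambda>x. a * f x) = a *\<^sub>R to_L2 f"
  using assms by (subst scaleR_L2.abs_eq) auto

lemma to_L2_diff:
  assumes "square_integrable f" "square_integrable g"
  shows "to_L2 (\<lambda>x. f x - g x) = to_L2 f - to_L2 g"
  using to_L2_add[OF assms(1) square_integrable_scale[OF assms(2), of "-1"]]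
    to_L2_scale[OF assms(2), of "-1"] by simp

lemma inner_to_L2:
  assumes "square_integrable f" "square_integrable g"
  shows "inner (to_L2 f) (to_L2 g) = integral\<^sup>L unit_measure (\<lambda>x. f x * g x)"
  using assms by (subst inner_L2.abs_eq) auto

lemma norm_to_L2:
  assumes "square_integrable f"
  shows "norm (to_L2 f) = sqrt (integral\<^sup>L unit_measure (\<lambda>x. (f x)\<^sup>2))"
  using inner_to_L2[OF assms assms] by (simp add: norm_eq_sqrt_inner power2_eq_square)

text \<open>
  Dominated convergence. Both density of continuous functions and removal of cutoffs rest on it.
\<close>

lemma to_L2_tendsto:
  assumes "square_integrable h" "square_integrable f"
    and "\<And>k. g k \<in> borel_measurable unit_measure"
    and "AE x in unit_measure. (\<lambda>k. g k x) \<longlonglongrightarrow> f x"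
    and "\<And>k. AE x in unit_measure. \<bar>g k x\<bar> \<le> h x"
  shows "\<And>k. square_integrable (g k)" "(\<lambda>k. norm (to_L2 f - to_L2 (g k))) \<longlonglongrightarrow> 0"
proof -
  have h2: "integrable unit_measure (\<lambda>x. (h x)\<^sup>2)" 
    using assms(1) by (simp add: square_integrable_def)
  show g: "square_integrable (g k)" for k
    unfolding square_integrable_def
  proof
    show "integrable unit_measure (\<lambda>x. (g k x)\<^sup>2)"
    proof (rule Bochner_Integration.integrable_bound[OF h2])
      show "AE x in unit_measure. norm ((g k x)\<^sup>2) \<le> norm ((h x)\<^sup>2)"
        using assms(5)[of k] 
      proof eventually_elim
        case (elim x)
        then show ?case using power_mono[OF elim abs_ge_zero, of 2] by simp
      qed
    qed (use assms(3) in auto)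
  qed (rule assms(3))
  have f: "f \<in> borel_measurable unit_measure" using assms(2) by (simp add: square_integrable_def)
  have "AE x in unit_measure. \<forall>k. \<bar>g k x\<bar> \<le> h x"
    by (subst AE_all_countable) (use assms(5) in blast)
  with assms(4) have fb: "AE x in unit_measure. \<bar>f x\<bar> \<le> h x"
  proof eventually_elim
    case (elim x)
    then show ?case by (intro LIMSEQ_le_const2[OF tendsto_rabs]) auto
  qed
  have "(\<lambda>k. integral\<^sup>L unit_measure (\<lambda>x. (f x - g k x)\<^sup>2)) \<longlonglongrightarrow> integral\<^sup>L unit_measure (\<lambda>x. 0)"
  proof (rule integral_dominated_convergence[where w = "\<lambda>x. 4 * (h x)\<^sup>2"])
    show "AE x in unit_measure. (\<lambda>k. (f x - g k x)\<^sup>2) \<longlonglongrightarrow> 0"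
      using assms(4)
    proof eventually_elim
      case (elim x)
      then have "(\<lambda>k. (f x - g k x)\<^sup>2) \<longlonglongrightarrow> (f x - f x)\<^sup>2" by (intro tendsto_intros)
      then show ?case by simp
    qed
    show "AE x in unit_measure. norm ((f x - g k x)\<^sup>2) \<le> 4 * (h x)\<^sup>2" for k
      using assms(5)[of k] fb
    proof eventually_elim
      case (elim x)
      then have "\<bar>f x - g k x\<bar> \<le> 2 * h x" by linarith
      then have "(f x - g k x)\<^sup>2 \<le> (2 * h x)\<^sup>2" by (metis power2_abs abs_ge_zero power_mono)
      then show ?case by (simp add: power_mult_distrib)
    qed
  qed (use assms(3) f h2 in \<open>auto\<close>)
  then have "(\<lambda>k. sqrt (integral\<^sup>L unit_measure (\<lambda>x. (f x - g k x)\<^sup>2))) \<longlonglongrightarrow> sqrt 0"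
    by (intro tendsto_real_sqrt) simp
  then show "(\<lambda>k. norm (to_L2 f - to_L2 (g k))) \<longlonglongrightarrow> 0"
    by (simp add: norm_to_L2 square_integrable_diff assms(2) g flip: to_L2_diff)
qed

definition clamp_abs :: "real \<Rightarrow> real \<Rightarrow> real" where
  "clamp_abs b y = max (- b) (min b y)"

text \<open>
  Truncation makes the function bounded. A bounded measurable function is an almost everywhere limit
  of continuous functions, and truncating these at the same height supplies the dominating constant.
\<close>

lemma continuous_dense_L2:
  assumes "e > 0"
  obtains g where "continuous_on UNIV g" "norm (u - to_L2 g) < e"
proof -
  obtain f where f: "square_integrable f" "u = to_L2 f" by (rule L2_cases)
  have fm: "f \<in> borel_measurable unit_measure" using f(1) by (simp add: square_integrable_def)
  define F where "F k x = clamp_abs (real k) (f x)" for k x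
  have Fm: "F k \<in> borel_measurable unit_measure" for k
    unfolding F_def clamp_abs_def using fm by measurable
  have "(\<lambda>k. F k x) \<longlonglongrightarrow> f x" for x
  proof (rule tendsto_eventually)
    obtain m :: nat where "\<bar>f x\<bar> \<le> real m" using real_arch_simple by blast
    then show "\<forall>\<^sub>F k in sequentially. F k x = f x"
      unfolding F_def clamp_abs_def by (intro eventually_sequentiallyI[of m]) auto
  qed
  moreover have "\<bar>F k x\<bar> \<le> \<bar>f x\<bar>" for k x
    unfolding F_def clamp_abs_def by auto
  moreover have "square_integrable (\<lambda>x. \<bar>f x\<bar>)"
    using f(1) by (auto simp: square_integrable_def)
  ultimately have F: "\<And>k. square_integrable (F k)" "(\<lambda>k. norm (to_L2 f - to_L2 (F k))) \<longlonglongrightarrow> 0"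
    using to_L2_tendsto[of "\<lambda>x. \<bar>f x\<bar>" f F] f Fm by auto
  obtain k where k: "norm (to_L2 f - to_L2 (F k)) < e / 2"
    using order_tendstoD(2)[OF F(2), of "e/2"] assms eventually_happens by fastforce
  have "F k measurable_on {0<..<1}"
    using Fm by (subst measurable_on_iff_borel_measurable) auto
  then obtain N g where N: "negligible N" and g: "\<And>n. continuous_on UNIV (g n)"
    and lim: "\<And>x. x \<notin> N \<Longrightarrow> (\<lambda>n. g n x) \<longlonglongrightarrow> (if x \<in> {0<..<1} then F k x else 0)"
    unfolding measurable_on_def by blast
  define h where "h n x = clamp_abs (real k) (g n x)" for n x
  have hc: "continuous_on UNIV (h n)" for n
    unfolding h_def clamp_abs_def using g by (intro continuous_intros) 
  have "AE x in lebesgue. x \<notin> N"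
    using N negligible_iff_null_sets AE_not_in by blast
  then have "AE x in unit_measure. x \<notin> N"
    by (subst AE_restrict_space_iff) auto
  then have ae: "AE x in unit_measure. (\<lambda>n. h n x) \<longlonglongrightarrow> F k x"
    using AE_space
  proof eventually_elim
    case (elim x)
    then have "(\<lambda>n. g n x) \<longlonglongrightarrow> F k x" using lim[of x] by simp
    then have "(\<lambda>n. h n x) \<longlonglongrightarrow> clamp_abs (real k) (F k x)"
      unfolding h_def clamp_abs_def by (intro tendsto_intros)
    then show ?case by (simp add: F_def clamp_abs_def)
  qed
  have sq: "square_integrable (h n)" for n
    using hc by (intro square_integrable_continuous) (rule continuous_on_subset, auto)
  have "(\<lambda>n. norm (to_L2 (F k) - to_L2 (h n))) \<longlonglongrightarrow> 0"
  proof (rule to_L2_tendsto[where h = "\<lambda>_. real k"])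
    show "h n \<in> borel_measurable unit_measure" for n 
      using sq by (simp add: square_integrable_def)
    show "square_integrable (\<lambda>_. real k)"
      by (rule square_integrable_continuous) auto
  qed (use ae F in \<open>auto simp: h_def clamp_abs_def\<close>)
  then obtain n where "norm (to_L2 (F k) - to_L2 (h n)) < e / 2"
    using order_tendstoD(2)[of _ 0 sequentially "e/2"] assms eventually_happens by fastforce
  with k have "norm (to_L2 f - to_L2 (h n)) < e"
    using norm_triangle_ineq[of "to_L2 f - to_L2 (F k)" "to_L2 (F k) - to_L2 (h n)"] by simp
  then show ?thesis using hc f that by blast
qed

section \<open>Completeness of the cosine basis\<close>

lemma norm_to_L2_le:
  assumes "continuous_on {0..1} g" "\<And>x. x \<in> {0<..<1} \<Longrightarrow> \<bar>g x\<bar> \<le> B" "0 \<le> B"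
  shows "norm (to_L2 g) \<le> B"
proof -
  have fin: "finite_measure unit_measure"
    by (rule finite_measure_lebesgue_on) (simp add: lmeasurable_interval)
  have sq: "square_integrable g" using assms(1) by (rule square_integrable_continuous)
  have "integral\<^sup>L unit_measure (\<lambda>x. (g x)\<^sup>2) \<le> integral\<^sup>L unit_measure (\<lambda>x. B\<^sup>2)"
  proof (rule integral_mono)
    show "(g x)\<^sup>2 \<le> B\<^sup>2" if "x \<in> space unit_measure" for x
      using power_mono[OF assms(2) abs_ge_zero, of x 2] that by simp
  qed (use sq in \<open>auto simp: square_integrable_def intro: finite_measure.integrable_const[OF fin]\<close>)
  also have "\<dots> = B\<^sup>2"
    by (simp add: measure_restrict_space)
  finally show ?thesis
    using assms(3) by (simp add: norm_to_L2[OF sq] real_le_lsqrt)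
qed

lemma integral_unit_measure_continuous:
  fixes g :: "real \<Rightarrow> real"
  assumes "continuous_on {0..1} g"
  shows "integrable unit_measure g" "integral\<^sup>L unit_measure g = integral {0..1} g"
proof -
  have "square_integrable g" "square_integrable (\<lambda>_. 1)"
    using assms by (auto intro!: square_integrable_continuous continuous_intros)
  from integrable_mult_square_integrable[OF this] show "integrable unit_measure g" by simp
  then show "integral\<^sup>L unit_measure g = integral {0..1} g"
    by (simp add: lebesgue_integral_eq_integral flip: integral_open_interval_real)
qed

lemma integral_unit_measure_cos:
  "integral\<^sup>L unit_measure (\<lambda>x. cos (of_int k * pi * x)) = (if k = 0 then 1 else 0)"
proof -
  let ?g = "\<lambda>x. cos (of_int k * pi * x)"
  have "integral\<^sup>L unit_measure ?g = integral {0..1} ?g"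
    by (intro integral_unit_measure_continuous continuous_intros)
  also have "\<dots> = (if k = 0 then 1 else 0)"
  proof (cases "k = 0")
    case False
    have "(?g has_integral (sin (of_int k * pi * 1) / (of_int k * pi)
        - sin (of_int k * pi * 0) / (of_int k * pi))) {0..1}"
      using False
      by (intro fundamental_theorem_of_calculus)
        (auto intro!: derivative_eq_intros simp flip: has_real_derivative_iff_has_vector_derivative)
    moreover have "sin (of_int k * pi) = 0"
      by (metis sin_zero_iff_int2)
    ultimately show ?thesis using False by (auto dest: integral_unique)
  qed simp
  finally show ?thesis .
qed

abbreviation cosine :: "nat \<Rightarrow> real \<Rightarrow> real" where
  "cosine n \<equiv> (\<lambda>x. cos (real n * pi * x))"

definition phi_scale :: "nat \<Rightarrow> real" where
  "phi_scale n = (if n = 0 then 1 else sqrt 2)"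

lemma phi_scale_nonzero [simp]: "phi_scale n \<noteq> 0"
  by (simp add: phi_scale_def)

lemma continuous_on_cosine: "continuous_on S (cosine n)"
  by (intro continuous_intros)

text \<open>
  Proofs work with the unnormalised cosines, so that the constant mode needs no separate treatment.
\<close>

lemma phi_eq: "phi n = phi_scale n *\<^sub>R to_L2 (cosine n)"
proof -
  have "phi n = to_L2 (\<lambda>x. if n = 0 then 1 else sqrt 2 * cos (real n * pi * x))"
    by (rule phi.abs_eq)
  also have "\<dots> = to_L2 (\<lambda>x. phi_scale n * cosine n x)"
    by (rule arg_cong[where f = to_L2]) (auto simp: phi_scale_def)
  finally show ?thesis
    by (simp add: to_L2_scale square_integrable_continuous continuous_on_cosine)
qed

lemma inner_phi: "inner (phi m) (phi n) = (if m = n then 1 else 0)"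
proof -
  have i: "integrable unit_measure (\<lambda>x. cos (of_int k * pi * x))" for k :: int
    by (intro integral_unit_measure_continuous continuous_intros)
  have *: "cosine m x * cosine n x
      = cos (of_int (int m - int n) * pi * x) / 2 + cos (of_int (int m + int n) * pi * x) / 2" for x
    by (simp add: cos_times_cos algebra_simps)
  have "inner (to_L2 (cosine m)) (to_L2 (cosine n))
      = integral\<^sup>L unit_measure (\<lambda>x. cosine m x * cosine n x)"
    by (intro inner_to_L2 square_integrable_continuous continuous_on_cosine)
  also have "\<dots> = integral\<^sup>L unit_measure (\<lambda>x. cos (of_int (int m - int n) * pi * x)) / 2
      + integral\<^sup>L unit_measure (\<lambda>x. cos (of_int (int m + int n) * pi * x)) / 2"
    unfolding *
    by (subst Bochner_Integration.integral_add) (auto simp only: i intro!: integrable_divide, simp)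
  finally show ?thesis
    unfolding integral_unit_measure_cos phi_eq by (auto simp: phi_scale_def)
qed

lemma cosine_in_span: "to_L2 (cosine n) \<in> span (range phi)"
proof -
  have "to_L2 (cosine n) = inverse (phi_scale n) *\<^sub>R phi n"
    by (simp add: phi_eq)
  then show ?thesis by (simp only:) (intro span_mul span_base rangeI)
qed

text \<open>
  The product-to-sum formula turns a polynomial in \<open>cos (pi x)\<close> into a sum of cosines. The extra
  factor \<open>cosine n\<close> makes the induction over the polynomial go through.
\<close>

lemma poly_cos_times_cosine_in_span:
  "to_L2 (\<lambda>x. poly p (cos (pi * x)) * cosine n x) \<in> span (range phi)"
proof (induction p arbitrary: n)
  case 0
  have "to_L2 (\<lambda>x. 0) = 0"
    by (simp add: zero_L2.abs_eq)
  then show ?case by (simp add: span_zero)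
next
  case (pCons a p)
  let ?P = "\<lambda>n x. poly p (cos (pi * x)) * cosine n x"
  have sq: "square_integrable (?P n)" "square_integrable (cosine n)"
    "square_integrable (\<lambda>x. b * cosine n x)"  "square_integrable (\<lambda>x. b * ?P n x)" for n b
    by (intro square_integrable_continuous continuous_intros)+
  have "\<exists>n'. \<forall>x. cos (pi * x) * cosine n x = (1/2) * cosine (Suc n) x + (1/2) * cosine n' x"
  proof (cases n)
    case 0
    then show ?thesis by (intro exI[of _ 1]) simp
  next
    case (Suc k)
    have "cos (pi * x) * cosine n x = (1/2) * cosine (Suc n) x + (1/2) * cosine k x" for x
      unfolding cos_times_cos Suc
      by (simp add: algebra_simps)
    then show ?thesis by blast
  qed
  then obtain n' where n': "\<And>x. cos (pi * x) * cosine n x = (1/2) * cosine (Suc n) x + (1/2) * cosine n' x"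
    by blast
  have "poly (pCons a p) (cos (pi * x)) * cosine n x
      = a * cosine n x + ((1/2) * ?P (Suc n) x + (1/2) * ?P n' x)" for x
  proof -
    have "poly (pCons a p) (cos (pi * x)) * cosine n x
      = a * cosine n x + poly p (cos (pi * x)) * (cos (pi * x) * cosine n x)"
      by (simp add: algebra_simps)
    then show ?thesis unfolding n' by (simp add: algebra_simps)
  qed
  then have "to_L2 (\<lambda>x. poly (pCons a p) (cos (pi * x)) * cosine n x)
      = a *\<^sub>R to_L2 (cosine n) + ((1/2) *\<^sub>R to_L2 (?P (Suc n)) + (1/2) *\<^sub>R to_L2 (?P n'))"
    by (simp only: to_L2_add to_L2_scale sq square_integrable_add)
  then show ?case
    using pCons.IH[of "Suc n"] pCons.IH[of n'] cosine_in_span[of n] by (auto intro!: span_add span_mul)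
qed

text \<open>
  Since \<open>cos (pi x)\<close> is injective on the closed unit interval, its polynomials form an algebra that
  separates points, and Stone-Weierstrass applies.
\<close>

lemma dense_span_phi:
  assumes "e > 0"
  obtains s where "s \<in> span (range phi)" "norm (u - s) < e"
proof -
  obtain g where g: "continuous_on UNIV g" "norm (u - to_L2 g) < e / 2"
    using continuous_dense_L2[of "e/2"] assms by auto
  have gc: "continuous_on {0..1} g" using g(1) by (rule continuous_on_subset) auto
  let ?R = "range (\<lambda>p x. poly p (cos (pi * x)))"
  interpret function_ring_on ?R "{0..1::real}"
  proof
    fix x y :: real assume "x \<in> {0..1}" "y \<in> {0..1}" "x \<noteq> y"
    then have "cos (pi * x) \<noteq> cos (pi * y)"
      using cos_inj_pi[of "pi * x" "pi * y"] by (auto simp: mult_left_le)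
    then show "\<exists>f\<in>?R. f x \<noteq> f y"
      by (intro bexI[of _ "\<lambda>x. poly [:0, 1:] (cos (pi * x))"] rangeI) simp
  next
    fix f g :: "real \<Rightarrow> real" assume "f \<in> ?R" "g \<in> ?R"
    then obtain p p' where pp: "f = (\<lambda>x. poly p (cos (pi * x)))" "g = (\<lambda>x. poly p' (cos (pi * x)))"
      by auto
    show "(\<lambda>x. f x + g x) \<in> ?R" "(\<lambda>x. f x * g x) \<in> ?R"
      unfolding pp by (auto simp flip: poly_add poly_mult)
  next
    fix k :: real
    have "(\<lambda>_. k) = (\<lambda>x. poly [:k:] (cos (pi * x)))" by simp
    then show "(\<lambda>_. k) \<in> ?R" by blast
  qed (auto intro!: continuous_intros)
  obtain h where h: "h \<in> ?R" "\<forall>x\<in>{0..1}. \<bar>g x - h x\<bar> < e / 2"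
    using Stone_Weierstrass_basic[OF gc half_gt_zero[OF assms]] by (rule bexE)
  from h(1) obtain p where hp: "h = (\<lambda>x. poly p (cos (pi * x)))" by (rule imageE)
  note p = bspec[OF h(2)[unfolded hp]]
  let ?p = "\<lambda>x. poly p (cos (pi * x))"
  have pc: "continuous_on {0..1} ?p" by (intro continuous_intros)
  have "norm (to_L2 (\<lambda>x. g x - ?p x)) \<le> e / 2"
    using p assms by (intro norm_to_L2_le continuous_intros gc) (auto simp: less_imp_le)
  then have "norm (to_L2 g - to_L2 ?p) \<le> e / 2"
    by (simp add: to_L2_diff square_integrable_continuous gc pc)
  then have "norm (u - to_L2 ?p) < e"
    using g(2) norm_triangle_ineq[of "u - to_L2 g" "to_L2 g - to_L2 ?p"] by simp
  then show ?thesis using that poly_cos_times_cosine_in_span[of p 0] by simp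
qed

lemma coef_simps:
  "coef (u + v) n = coef u n + coef v n" "coef (u - v) n = coef u n - coef v n"
  "coef (a *\<^sub>R u) n = a * coef u n" "coef 0 n = 0" "coef (- u) n = - coef u n"
  by (simp_all add: coef_def inner_simps)

lemma coef_phi: "coef (phi m) n = (if m = n then 1 else 0)"
  by (simp add: coef_def inner_phi)

lemma coef_G_proj: "coef (G_proj N u) n = (if n \<le> N then coef u n else 0)"
  unfolding G_proj_def coef_def inner_sum_left by (simp add: inner_phi if_distrib sum.delta cong: if_cong)

lemma inner_G_proj: "inner (G_proj N u) v = (\<Sum>n\<le>N. coef u n * coef v n)"
  unfolding G_proj_def inner_sum_left by (simp add: coef_def inner_commute)

lemma inner_G_proj_right: "inner u (G_proj N v) = (\<Sum>n\<le>N. coef u n * coef v n)"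
  by (subst inner_commute) (simp add: inner_G_proj mult.commute)

lemma norm_G_proj: "norm (G_proj N u) = L2_set (coef u) {..N}"
  by (simp add: norm_eq_sqrt_inner inner_G_proj coef_G_proj L2_set_def power2_eq_square)

lemma norm_G_proj_le: "norm (G_proj N u) \<le> norm u"
proof -
  have "(norm (G_proj N u))\<^sup>2 = inner u (G_proj N u)"
    by (simp add: power2_norm_eq_inner inner_G_proj inner_G_proj_right coef_G_proj)
  also have "\<dots> \<le> norm u * norm (G_proj N u)"
    by (rule norm_cauchy_schwarz)
  finally show ?thesis
    by (cases "norm (G_proj N u) = 0") (auto simp: power2_eq_square)
qed

lemma G_proj_diff: "G_proj N (u - v) = G_proj N u - G_proj N v"
  by (simp add: G_proj_def coef_simps scaleR_diff_left sum_subtractf)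

lemma norm_minus_G_proj_le: "norm (u - G_proj N u) \<le> norm u"
proof -
  have "(norm (u - G_proj N u))\<^sup>2 = inner u u - inner (G_proj N u) (G_proj N u)"
    by (simp add: power2_norm_eq_inner inner_diff_left inner_diff_right inner_G_proj
        inner_G_proj_right coef_G_proj coef_simps)
  also have "\<dots> \<le> (norm u)\<^sup>2" by (simp add: power2_norm_eq_inner)
  finally show ?thesis by (rule power2_le_imp_le) simp
qed

lemma span_phi_G_proj:
  assumes "s \<in> span (range phi)"
  obtains m where "\<And>k. m \<le> k \<Longrightarrow> G_proj k s = s"
proof -
  have "\<exists>m. \<forall>k\<ge>m. G_proj k s = s"
    using assms
  proof (induction rule: span_induct_alt)
    case base
    then show ?case by (simp add: G_proj_def coef_simps)
  next
    case (step a x y)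
    then obtain n m where x: "x = phi n" and m: "\<And>k. k \<ge> m \<Longrightarrow> G_proj k y = y" by auto
    have "G_proj k (a *\<^sub>R x + y) = a *\<^sub>R x + y" if "k \<ge> max n m" for k
    proof -
      have "G_proj k (a *\<^sub>R x + y) = a *\<^sub>R (\<Sum>i\<le>k. coef x i *\<^sub>R phi i) + G_proj k y"
        unfolding G_proj_def by (simp add: coef_simps scaleR_add_left sum.distrib scaleR_right.sum)
      also have "(\<Sum>i\<le>k. coef x i *\<^sub>R phi i) = (\<Sum>i\<le>k. if i = n then phi i else 0)"
        unfolding x by (intro sum.cong) (auto simp: coef_phi)
      finally show ?thesis using that m[of k] x by simp
    qed
    then show ?case by blast
  qed
  then show ?thesis using that by blast
qed

text \<open>
  Elements of the span are reproduced by all sufficiently large projections, and the complementary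
  projection is a contraction, so that density of the span suffices.
\<close>

lemma G_proj_tendsto: "(\<lambda>m. G_proj m u) \<longlonglongrightarrow> u"
proof (rule LIMSEQ_I)
  fix e :: real assume "e > 0"
  then obtain s where s: "s \<in> span (range phi)" "norm (u - s) < e" by (rule dense_span_phi)
  obtain m where m: "\<And>k. m \<le> k \<Longrightarrow> G_proj k s = s" using span_phi_G_proj[OF s(1)] by blast
  have "norm (G_proj k u - u) < e" if "k \<ge> m" for k
  proof -
    have "norm (G_proj k u - u) = norm ((u - s) - G_proj k (u - s))"
      using m[OF that] by (simp add: G_proj_diff norm_minus_commute)
    also have "\<dots> \<le> norm (u - s)" by (rule norm_minus_G_proj_le)
    finally show ?thesis using s(2) by simp
  qed
  then show "\<exists>m. \<forall>k\<ge>m. norm (G_proj k u - u) < e" by blast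
qed

lemma L2_eqI_coef:
  assumes "\<And>n. coef u n = coef v n"
  shows "u = v"
proof (rule LIMSEQ_unique)
  show "(\<lambda>m. G_proj m v) \<longlonglongrightarrow> v" by (rule G_proj_tendsto)
  have "G_proj m u = G_proj m v" for m
    unfolding G_proj_def assms ..
  then show "(\<lambda>m. G_proj m v) \<longlonglongrightarrow> u"
    using G_proj_tendsto[of u] by simp
qed

text \<open>
  Modewise domination of the tail carries over to norms by completeness of the basis on the left
  and Bessel's inequality on the right.
\<close>

lemma norm_tail_le:
  assumes "\<And>n. n > N \<Longrightarrow> \<bar>coef v n\<bar> \<le> a * \<bar>coef v0 n\<bar>" "0 \<le> a"
  shows "norm (v - G_proj N v) \<le> a * norm v0"
proof -
  have "norm (G_proj m (v - G_proj N v)) \<le> a * norm v0" for m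
  proof -
    have "norm (G_proj m (v - G_proj N v)) = L2_set (coef (v - G_proj N v)) {..m}"
      by (rule norm_G_proj)
    also have "\<dots> = L2_set (\<lambda>n. \<bar>coef (v - G_proj N v) n\<bar>) {..m}"
      by (simp add: L2_set_def)
    also have "\<dots> \<le> L2_set (\<lambda>n. a * \<bar>coef v0 n\<bar>) {..m}"
      by (rule L2_set_mono) (use assms in \<open>auto simp: coef_simps coef_G_proj\<close>)
    also have "\<dots> = a * norm (G_proj m v0)"
      unfolding norm_G_proj L2_set_right_distrib[OF assms(2)]
      by (simp add: L2_set_def power_mult_distrib)
    also have "\<dots> \<le> a * norm v0"
      using assms(2) norm_G_proj_le by (rule mult_left_mono[rotated])
    finally show ?thesis .
  qed
  then show ?thesis
    using LIMSEQ_le_const2[OF tendsto_norm[OF G_proj_tendsto]] by blast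
qed

lemma norm_le_low_plus_tail:
  assumes "\<And>n. n > N \<Longrightarrow> \<bar>coef v n\<bar> \<le> a * \<bar>coef v0 n\<bar>" "0 \<le> a"
  shows "norm v \<le> L2_set (coef v) {..N} + a * norm v0"
  using norm_tail_le[of N v a v0] assms norm_triangle_ineq[of "G_proj N v" "v - G_proj N v"]
  by (simp add: norm_G_proj)

section \<open>Weak derivatives in the cosine basis\<close>

lemma DERIV_max_square: "((\<lambda>x. (max 0 x)\<^sup>2) has_real_derivative 2 * max 0 x) (at (x::real))"
proof -
  consider "x < 0" | "x > 0" | "x = 0" by linarith
  then show ?thesis
  proof cases
    case 1
    have "((\<lambda>x. 0) has_real_derivative 2 * max 0 x) (at x)" using 1 by simp
    then show ?thesis
      by (rule has_field_derivative_transform_within_open[where S = "{..<0}"]) (use 1 in auto)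
  next
    case 2
    have "((\<lambda>x. x\<^sup>2) has_real_derivative 2 * max 0 x) (at x)"
      using 2 by (auto intro!: derivative_eq_intros)
    then show ?thesis
      by (rule has_field_derivative_transform_within_open[where S = "{0<..}"]) (use 2 in auto)
  next
    case 3
    have "(\<lambda>h. ((max 0 (0 + h))\<^sup>2 - (max 0 0)\<^sup>2) / h) \<midarrow>0\<rightarrow> (0::real)"
    proof (rule Lim_null_comparison)
      show "\<forall>\<^sub>F h in at 0. norm (((max 0 (0 + h))\<^sup>2 - (max 0 0)\<^sup>2) / h) \<le> \<bar>h::real\<bar>"
        by (intro always_eventually allI) (auto simp: max_def power2_eq_square)
      show "((\<lambda>h::real. \<bar>h\<bar>) \<longlongrightarrow> 0) (at 0)"
        by (rule tendsto_rabs_zero) (rule tendsto_ident_at)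
    qed
    then show ?thesis unfolding 3 DERIV_def by simp
  qed
qed

text \<open>
  The primitive of the hat function on the unit interval: a continuously differentiable transition
  from 0 to 1.
\<close>

definition step :: "real \<Rightarrow> real" where
  "step s = 2 * (max 0 s)\<^sup>2 - 4 * (max 0 (s - 1/2))\<^sup>2 + 2 * (max 0 (s - 1))\<^sup>2"

definition hat :: "real \<Rightarrow> real" where
  "hat s = 4 * max 0 s - 8 * max 0 (s - 1/2) + 4 * max 0 (s - 1)"

lemma DERIV_step [derivative_intros]:
  assumes "(g has_real_derivative g') (at x within S)"
  shows "((\<lambda>x. step (g x)) has_real_derivative hat (g x) * g') (at x within S)"
proof (rule DERIV_chain2[OF _ assms])
  have shift: "((\<lambda>s. (max 0 (s - a))\<^sup>2) has_real_derivative 2 * max 0 (s - a)) (at s)" for s a :: real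
  proof -
    have "((\<lambda>s. s - a) has_real_derivative 1) (at s)"
      by (auto intro!: derivative_eq_intros)
    from DERIV_chain2[where f = "\<lambda>x. (max 0 x)\<^sup>2", OF DERIV_max_square this] show ?thesis by simp
  qed
  show "(step has_real_derivative hat (g x)) (at (g x))"
    unfolding step_def[abs_def] hat_def
    by (rule derivative_eq_intros DERIV_max_square shift refl | simp)+
qed

lemma continuous_on_hat [continuous_intros]:
  "continuous_on S g \<Longrightarrow> continuous_on S (\<lambda>x. hat (g x))"
  unfolding hat_def by (intro continuous_intros)

lemma continuous_on_step [continuous_intros]:
  "continuous_on S g \<Longrightarrow> continuous_on S (\<lambda>x. step (g x))"
  unfolding step_def by (intro continuous_intros)

lemma step_eq_0: "s \<le> 0 \<Longrightarrow> step s = 0" and hat_eq_0: "s \<le> 0 \<or> 1 \<le> s \<Longrightarrow> hat s = 0"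
  and hat_bounds: "0 \<le> hat s" "hat s \<le> 2"
  by (auto simp: step_def hat_def max_def)

lemma step_eq_1: "1 \<le> s \<Longrightarrow> step s = 1"
  by (simp add: step_def max_def power2_eq_square algebra_simps)

lemma step_bounds: "0 \<le> step s" "step s \<le> 1"
proof -
  consider "s \<le> 0" | "0 \<le> s" "s \<le> 1/2" | "1/2 \<le> s" "s \<le> 1" | "1 \<le> s" by linarith
  then have "0 \<le> step s \<and> step s \<le> 1"
  proof cases
    case 2
    then have "step s = 2 * s\<^sup>2" by (simp add: step_def)
    moreover have "s\<^sup>2 \<le> (1/2)\<^sup>2" using 2 by (intro power_mono)
    ultimately show ?thesis by (simp add: power2_eq_square)
  next
    case 3
    then have "step s = 1 - 2 * (1 - s)\<^sup>2"
      by (simp add: step_def power2_eq_square algebra_simps)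
    moreover have "(1 - s)\<^sup>2 \<le> (1/2)\<^sup>2" using 3 by (intro power_mono) auto
    ultimately show ?thesis by (simp add: power2_eq_square)
  qed (auto simp: step_eq_0 step_eq_1)
  then show "0 \<le> step s" "step s \<le> 1" by auto
qed

text \<open>
  For \<open>k > 0\<close>, equal to 1 at the points of the unit interval whose distance to both ends is at least
  \<open>2 / k\<close>, and to 0 outside \<open>{1 / k..1 - 1 / k}\<close>, so that multiplying by it turns smooth functions into test functions.
\<close>

definition cutoff :: "real \<Rightarrow> real \<Rightarrow> real" where
  "cutoff k x = step (k * x - 1) * step (k * (1 - x) - 1)"

definition cutoff_deriv :: "real \<Rightarrow> real \<Rightarrow> real" where
  "cutoff_deriv k x = k * hat (k * x - 1) * step (k * (1 - x) - 1)
     - k * step (k * x - 1) * hat (k * (1 - x) - 1)"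

lemma DERIV_cutoff: "(cutoff k has_real_derivative cutoff_deriv k x) (at x)"
  unfolding cutoff_def[abs_def] cutoff_deriv_def by (auto intro!: derivative_eq_intros)

lemma continuous_on_cutoff: "continuous_on S (cutoff k)" "continuous_on S (cutoff_deriv k)"
  unfolding cutoff_def[abs_def] cutoff_deriv_def[abs_def] by (intro continuous_intros)+

lemma cutoff_bounds: "0 \<le> cutoff k x" "cutoff k x \<le> 1"
  by (auto simp: cutoff_def step_bounds mult_le_one)

lemma abs_cutoff_deriv_le:
  assumes "0 \<le> k"
  shows "\<bar>cutoff_deriv k x\<bar> \<le> k * hat (k * x - 1) + k * hat (k * (1 - x) - 1)"
proof -
  have "\<bar>cutoff_deriv k x\<bar> \<le> \<bar>k * hat (k * x - 1) * step (k * (1 - x) - 1)\<bar>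
      + \<bar>k * step (k * x - 1) * hat (k * (1 - x) - 1)\<bar>"
    unfolding cutoff_deriv_def by (rule abs_triangle_ineq4)
  also have "\<dots> = k * hat (k * x - 1) * step (k * (1 - x) - 1)
      + k * hat (k * (1 - x) - 1) * step (k * x - 1)"
    using assms by (simp add: abs_mult step_bounds hat_bounds mult_ac)
  also have "\<dots> \<le> k * hat (k * x - 1) + k * hat (k * (1 - x) - 1)"
    using assms by (intro add_mono mult_left_le) (auto simp: step_bounds hat_bounds)
  finally show ?thesis .
qed

lemma cutoff_eventually:
  assumes "x \<in> {0<..<1}"
  shows "\<forall>\<^sub>F k in sequentially. cutoff (real k) x = 1 \<and> cutoff_deriv (real k) x = 0"
proof -
  obtain m :: nat where m: "2 / x \<le> real m" using real_arch_simple by blast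
  obtain m' :: nat where m': "2 / (1 - x) \<le> real m'" using real_arch_simple by blast
  have "cutoff (real k) x = 1 \<and> cutoff_deriv (real k) x = 0" if "k \<ge> max m m'" for k
  proof -
    have "2 / x \<le> real k" "2 / (1 - x) \<le> real k" using that m m' by linarith+
    then have "1 \<le> real k * x - 1" "1 \<le> real k * (1 - x) - 1"
      using assms by (auto simp: divide_le_eq)
    then show ?thesis by (simp add: cutoff_def cutoff_deriv_def step_eq_1 hat_eq_0)
  qed
  then show ?thesis by (rule eventually_sequentiallyI)
qed

lemma test_function_cutoff:
  assumes "\<And>x. (p has_real_derivative p' x) (at x)" "continuous_on UNIV p'" "1 \<le> k"
  shows "test_function (\<lambda>x. p x * cutoff k x) (\<lambda>x. p' x * cutoff k x + p x * cutoff_deriv k x)"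
  unfolding test_function_def
proof (intro conjI allI exI)
  have pc: "continuous_on UNIV p"
    by (rule DERIV_continuous_on, rule has_field_derivative_at_within, rule assms(1))
  show "continuous_on UNIV (\<lambda>x. p' x * cutoff k x + p x * cutoff_deriv k x)"
    by (intro continuous_intros assms(2) pc continuous_on_cutoff)
  show "((\<lambda>x. p x * cutoff k x) has_real_derivative p' x * cutoff k x + p x * cutoff_deriv k x) (at x)" for x
    by (auto intro!: derivative_eq_intros assms(1) DERIV_cutoff)
  show "0 < 1 / k" "1 - 1 / k < 1" using assms(3) by auto
  show "x \<notin> {1 / k..1 - 1 / k} \<longrightarrow> p x * cutoff k x = 0" for x
  proof
    assume "x \<notin> {1 / k..1 - 1 / k}"
    then have "x < 1 / k \<or> 1 - x < 1 / k"
      by auto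
    then have "x * k < 1 \<or> (1 - x) * k < 1"
      using assms(3) by (simp add: less_divide_eq)
    then have "k * x - 1 \<le> 0 \<or> k * (1 - x) - 1 \<le> 0"
      by (simp add: mult.commute) linarith
    then show "p x * cutoff k x = 0" by (auto simp: cutoff_def step_eq_0)
  qed
qed

lemma to_L2_cutoff_tendsto:
  assumes "continuous_on UNIV p"
  shows "(\<lambda>k. to_L2 (\<lambda>x. p x * cutoff (real k) x)) \<longlonglongrightarrow> to_L2 p"
proof -
  have sq: "square_integrable p" "square_integrable (\<lambda>x. \<bar>p x\<bar>)"
    "square_integrable (\<lambda>x. p x * cutoff (real k) x)" for k
    using continuous_on_subset[OF assms, of "{0..1}"]
    by (auto intro!: square_integrable_continuous continuous_intros continuous_on_cutoff)
  have "(\<lambda>k. norm (to_L2 p - to_L2 (\<lambda>x. p x * cutoff (real k) x))) \<longlonglongrightarrow> 0"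
  proof (rule to_L2_tendsto[OF sq(2,1)])
    show "(\<lambda>x. p x * cutoff (real k) x) \<in> borel_measurable unit_measure" for k
      using sq(3) by (simp add: square_integrable_def)
    show "AE x in unit_measure. (\<lambda>k. p x * cutoff (real k) x) \<longlonglongrightarrow> p x"
    proof (rule AE_I2)
      fix x assume "x \<in> space unit_measure"
      then have "x \<in> {0<..<1}" by simp
      from cutoff_eventually[OF this] have "\<forall>\<^sub>F k in sequentially. p x * cutoff (real k) x = p x"
        by (rule eventually_mono) simp
      then show "(\<lambda>k. p x * cutoff (real k) x) \<longlonglongrightarrow> p x" by (rule tendsto_eventually)
    qed
    show "AE x in unit_measure. \<bar>p x * cutoff (real k) x\<bar> \<le> \<bar>p x\<bar>" for k
      by (intro AE_I2) (simp add: abs_mult cutoff_bounds mult_left_le)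
  qed
  then have "(\<lambda>k. norm (to_L2 (\<lambda>x. p x * cutoff (real k) x) - to_L2 p)) \<longlonglongrightarrow> 0"
    by (subst norm_minus_commute)
  then show ?thesis by (rule LIM_zero_cancel[OF tendsto_norm_zero_cancel])
qed

text \<open>
  Integration by parts against functions without compact support. Multiplied by a cutoff, \<open>p\<close> becomes
  a test function, and the only extra term in the limit is the one with the derivative of the cutoff;
  the last hypothesis says that no boundary term arises from it.
\<close>

lemma weak_deriv_by_parts:
  assumes "weak_deriv u v"
    and "\<And>x. (p has_real_derivative p' x) (at x)" "continuous_on UNIV p'"
    and "(\<lambda>k. inner u (to_L2 (\<lambda>x. p x * cutoff_deriv (real k) x))) \<longlonglongrightarrow> 0"
  shows "inner u (to_L2 p') = - inner v (to_L2 p)"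
proof -
  have pc: "continuous_on UNIV p"
    by (rule DERIV_continuous_on, rule has_field_derivative_at_within, rule assms(2))
  have sq: "square_integrable (\<lambda>x. p' x * cutoff k x)" "square_integrable (\<lambda>x. p x * cutoff_deriv k x)" for k
    using continuous_on_subset[OF pc, of "{0..1}"] continuous_on_subset[OF assms(3), of "{0..1}"]
    by (auto intro!: square_integrable_continuous continuous_intros continuous_on_cutoff)
  have "(\<lambda>k. inner u (to_L2 (\<lambda>x. p' x * cutoff (real k) x))
      + inner u (to_L2 (\<lambda>x. p x * cutoff_deriv (real k) x))) \<longlonglongrightarrow> inner u (to_L2 p') + 0"
    by (intro tendsto_intros to_L2_cutoff_tendsto assms)
  moreover have "\<forall>\<^sub>F k in sequentially. inner u (to_L2 (\<lambda>x. p' x * cutoff (real k) x))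
      + inner u (to_L2 (\<lambda>x. p x * cutoff_deriv (real k) x)) = - inner v (to_L2 (\<lambda>x. p x * cutoff (real k) x))"
  proof (rule eventually_sequentiallyI[of 1])
    fix k :: nat assume "1 \<le> k"
    then have "inner u (to_L2 (\<lambda>x. p' x * cutoff (real k) x + p x * cutoff_deriv (real k) x))
        = - inner v (to_L2 (\<lambda>x. p x * cutoff (real k) x))"
      using assms(1) test_function_cutoff[OF assms(2,3), of "real k"]
      unfolding weak_deriv_def by simp
    then show "inner u (to_L2 (\<lambda>x. p' x * cutoff (real k) x))
      + inner u (to_L2 (\<lambda>x. p x * cutoff_deriv (real k) x)) = - inner v (to_L2 (\<lambda>x. p x * cutoff (real k) x))"
      by (simp add: to_L2_add sq inner_add_right)
  qed
  ultimately have "(\<lambda>k. - inner v (to_L2 (\<lambda>x. p x * cutoff (real k) x))) \<longlonglongrightarrow> inner u (to_L2 p')"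
    using Lim_transform_eventually by fastforce
  moreover have "(\<lambda>k. - inner v (to_L2 (\<lambda>x. p x * cutoff (real k) x))) \<longlonglongrightarrow> - inner v (to_L2 p)"
    by (intro tendsto_intros to_L2_cutoff_tendsto pc)
  ultimately show ?thesis by (rule LIMSEQ_unique)
qed

text \<open>
  Two weak derivatives agree on all cut-off cosines, hence on the complete cosine basis.
\<close>

lemma weak_deriv_unique:
  assumes "weak_deriv u v" "weak_deriv u v'"
  shows "v = v'"
proof (rule L2_eqI_coef)
  fix n
  let ?p = "\<lambda>k x. cosine n x * cutoff (real k) x"
  have D: "(cosine n has_real_derivative - (real n * pi) * sin (real n * pi * x)) (at x)" for x
    by (auto intro!: derivative_eq_intros)
  have "inner v (to_L2 (?p k)) = inner v' (to_L2 (?p k))" if "k \<ge> 1" for k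
  proof -
    have "test_function (?p k) (\<lambda>x. - (real n * pi) * sin (real n * pi * x) * cutoff (real k) x
        + cosine n x * cutoff_deriv (real k) x)"
      by (rule test_function_cutoff) (use that D in \<open>auto intro!: continuous_intros\<close>)
    then have "- inner v (to_L2 (?p k)) = - inner v' (to_L2 (?p k))"
      using assms unfolding weak_deriv_def by fastforce
    then show ?thesis by linarith
  qed
  then have "\<forall>\<^sub>F k in sequentially. inner v (to_L2 (?p k)) = inner v' (to_L2 (?p k))"
    by (rule eventually_sequentiallyI)
  moreover have "(\<lambda>k. inner w (to_L2 (?p k))) \<longlonglongrightarrow> inner w (to_L2 (cosine n))" for w
    by (intro tendsto_intros to_L2_cutoff_tendsto continuous_on_cosine)
  ultimately have "inner v (to_L2 (cosine n)) = inner v' (to_L2 (cosine n))"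
    by (intro LIMSEQ_unique[OF Lim_transform_eventually])
  then show "coef v n = coef v' n" by (simp add: coef_def phi_eq)
qed

lemma Dx_eqI: "weak_deriv u v \<Longrightarrow> Dx u = v"
  unfolding Dx_def by (rule the_equality) (auto intro: weak_deriv_unique)

lemma weak_deriv_Dx:
  assumes "u \<in> Sobolev (Suc k)"
  shows "weak_deriv u (Dx u)"
proof -
  obtain v where "weak_deriv u v" using assms by auto
  then show ?thesis using Dx_eqI by metis
qed

text \<open>
  Near an end of the interval \<open>p\<close> is at most a constant times the distance \<open>y\<close> to that end, while the
  derivative of the cutoff is of size \<open>k\<close> and supported where \<open>y \<le> 2 / k\<close>. The product is thus
  uniformly bounded and vanishes pointwise in the limit.
\<close>

lemma inner_cutoff_deriv_vanishing_test:
  assumes "\<And>x. (p has_real_derivative p' x) (at x)" "continuous_on UNIV p'" "p 0 = 0" "p 1 = 0"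
  shows "(\<lambda>k. inner u (to_L2 (\<lambda>x. p x * cutoff_deriv (real k) x))) \<longlonglongrightarrow> 0"
proof -
  have "compact (p' ` {0..1})"
    using assms(2) by (intro compact_continuous_image) (auto intro: continuous_on_subset)
  then obtain C where C: "\<And>x. x \<in> {0..1} \<Longrightarrow> \<bar>p' x\<bar> \<le> C"
    by (metis compact_imp_bounded bounded_iff imageI real_norm_def)
  have C0: "0 \<le> C" using C[of 0] by simp
  have lip: "\<bar>p x - p y\<bar> \<le> C * \<bar>x - y\<bar>" if "x \<in> {0..1}" "y \<in> {0..1}" for x y
    using field_differentiable_bound[of "{0..1}" p p' C x y] C that
      has_field_derivative_at_within[OF assms(1)] by auto
  have bound: "\<bar>p x * cutoff_deriv (real k) x\<bar> \<le> 8 * C" if x: "x \<in> {0<..<1}" for k x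
  proof -
    have px: "\<bar>p x\<bar> \<le> C * x" "\<bar>p x\<bar> \<le> C * (1 - x)"
      using lip[of x 0] lip[of x 1] x assms(3,4) by auto
    have *: "\<bar>p x\<bar> * (real k * hat (real k * y - 1)) \<le> 4 * C" if "y > 0" "\<bar>p x\<bar> \<le> C * y" for y
    proof (cases "real k * y \<le> 2")
      case True
      have "\<bar>p x\<bar> * (real k * hat (real k * y - 1)) \<le> (C * y) * (real k * 2)"
        using that C0 by (intro mult_mono) (auto simp: hat_bounds)
      also have "\<dots> = (2 * C) * (real k * y)" by simp
      also have "\<dots> \<le> (2 * C) * 2" using True C0 by (intro mult_left_mono) auto
      finally show ?thesis by simp
    next
      case False
      then show ?thesis using C0 by (simp add: hat_eq_0)
    qed
    have "\<bar>p x * cutoff_deriv (real k) x\<bar>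
      \<le> \<bar>p x\<bar> * (real k * hat (real k * x - 1) + real k * hat (real k * (1 - x) - 1))"
      unfolding abs_mult by (intro mult_left_mono abs_cutoff_deriv_le) auto
    also have "\<dots> \<le> 4 * C + 4 * C"
      unfolding distrib_left using x px by (intro add_mono *) auto
    finally show ?thesis by simp
  qed
  have pc: "continuous_on UNIV p"
    by (rule DERIV_continuous_on, rule has_field_derivative_at_within, rule assms(1))
  have sq: "square_integrable (\<lambda>x. p x * cutoff_deriv (real k) x)" for k
    using continuous_on_subset[OF pc, of "{0..1}"]
    by (auto intro!: square_integrable_continuous continuous_intros continuous_on_cutoff)
  have "(\<lambda>k. norm (to_L2 (\<lambda>_. 0) - to_L2 (\<lambda>x. p x * cutoff_deriv (real k) x))) \<longlonglongrightarrow> 0"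
  proof (rule to_L2_tendsto[where h = "\<lambda>_. 8 * C"])
    show "(\<lambda>x. p x * cutoff_deriv (real k) x) \<in> borel_measurable unit_measure" for k
      using sq by (simp add: square_integrable_def)
    show "AE x in unit_measure. (\<lambda>k. p x * cutoff_deriv (real k) x) \<longlonglongrightarrow> 0"
    proof (rule AE_I2)
      fix x assume "x \<in> space unit_measure"
      then have "x \<in> {0<..<1}" by simp
      from cutoff_eventually[OF this] have "\<forall>\<^sub>F k in sequentially. p x * cutoff_deriv (real k) x = 0"
        by (rule eventually_mono) simp
      then show "(\<lambda>k. p x * cutoff_deriv (real k) x) \<longlonglongrightarrow> 0" by (rule tendsto_eventually)
    qed
  qed (use bound in \<open>auto intro!: square_integrable_continuous AE_I2\<close>)
  then have "(\<lambda>k. norm (to_L2 (\<lambda>x. p x * cutoff_deriv (real k) x))) \<longlonglongrightarrow> 0"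
    by (simp flip: zero_L2.abs_eq)
  then have "(\<lambda>k. inner u (to_L2 (\<lambda>x. p x * cutoff_deriv (real k) x))) \<longlonglongrightarrow> inner u 0"
    by (intro tendsto_intros) (rule tendsto_norm_zero_cancel)
  then show ?thesis by simp
qed

text \<open>
  Continuous representatives of one class agree off a null set. They agree everywhere, since the
  set on which they differ is open in the open interval and a nonempty open set is not negligible.
\<close>

lemma boundary_value_common:
  assumes "boundary_value u 0 a" "boundary_value u 1 b"
  obtains g where "continuous_on {0..1} g" "u = to_L2 g" "g 0 = a" "g 1 = b"
proof -
  obtain g where g: "continuous_on {0..1} g" "u = to_L2 g" "g 0 = a"
    using assms(1) unfolding boundary_value_def by blast
  obtain h where h: "continuous_on {0..1} h" "u = to_L2 h" "h 1 = b"
    using assms(2) unfolding boundary_value_def by blast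
  let ?f = "\<lambda>x. g x - h x"
  have fc: "continuous_on {0..1} ?f" using g h by (intro continuous_intros)
  have "AE x in unit_measure. g x = h x"
    using g h by (subst to_L2_eq_iff[symmetric]) (auto intro: square_integrable_continuous)
  then have "AE x in lebesgue. x \<in> {0<..<1} \<longrightarrow> g x = h x"
    by (subst (asm) AE_restrict_space_iff) auto
  then have neg: "negligible {x. \<not> (x \<in> {0<..<1} \<longrightarrow> g x = h x)}"
    unfolding eventually_ae_filter using negligible_subset by (auto simp: negligible_iff_null_sets)
  have "open ({0<..<1} \<inter> ?f -` (- {0}))"
    by (rule continuous_open_preimage) (auto intro: continuous_on_subset[OF fc])
  moreover have "{0<..<1} \<inter> ?f -` (- {0}) \<subseteq> {x. \<not> (x \<in> {0<..<1} \<longrightarrow> g x = h x)}"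
    by auto
  ultimately have "{0<..<1} \<inter> ?f -` (- {0}) = {}"
    using negligible_subset[OF neg] open_not_negligible by blast
  then have "?f x = 0" if "x \<in> {0<..<1}" for x using that by blast
  then have "?f 1 = 0"
    using continuous_constant_on_closure[of "{0<..<1}" ?f 0 1] fc by (simp add: closure_greaterThanLessThan)
  then show ?thesis using that g h by simp
qed

text \<open>
  The integrand dominates the derivative of the cutoff. It is the derivative of a difference of two
  transitions, which bounds its mass independently of \<open>k\<close>.
\<close>

lemma integral_hat_sum_le:
  assumes "0 \<le> k"
  shows "integral\<^sup>L unit_measure (\<lambda>x. k * hat (k * x - 1) + k * hat (k * (1 - x) - 1)) \<le> 2"
proof -
  let ?F = "\<lambda>x. step (k * x - 1) - step (k * (1 - x) - 1)"
  let ?f = "\<lambda>x. k * hat (k * x - 1) + k * hat (k * (1 - x) - 1)"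
  have "(?f has_integral (?F 1 - ?F 0)) {0..1}"
    by (intro fundamental_theorem_of_calculus)
      (auto intro!: derivative_eq_intros simp flip: has_real_derivative_iff_has_vector_derivative)
  then have "integral\<^sup>L unit_measure ?f = ?F 1 - ?F 0"
    by (subst integral_unit_measure_continuous) (auto intro!: continuous_intros integral_unique)
  also have "\<dots> \<le> 2"
    using step_bounds[of "k - 1"] by (simp add: step_eq_0)
  finally show ?thesis .
qed

text \<open>
  Here the boundary condition is carried by \<open>u\<close> instead of the test function. The continuous
  representative is uniformly small on the boundary strips, on which the derivative of the cutoff
  has bounded mass.
\<close>

lemma inner_cutoff_deriv_vanishing_boundary:
  assumes "boundary_value u 0 0" "boundary_value u 1 0" "continuous_on UNIV p"
  shows "(\<lambda>k. inner u (to_L2 (\<lambda>x. p x * cutoff_deriv (real k) x))) \<longlonglongrightarrow> 0"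
proof -
  obtain g where g: "continuous_on {0..1} g" "u = to_L2 g" "g 0 = 0" "g 1 = 0"
    using boundary_value_common[OF assms(1,2)] by blast
  let ?f = "\<lambda>x. g x * p x"
  have pc: "continuous_on {0..1} p" using assms(3) by (rule continuous_on_subset) auto
  have fc: "continuous_on {0..1} ?f" using g(1) pc by (intro continuous_intros)
  have "(\<lambda>k. integral\<^sup>L unit_measure (\<lambda>x. ?f x * cutoff_deriv (real k) x)) \<longlonglongrightarrow> 0"
  proof (rule LIMSEQ_I)
    fix e :: real assume e: "e > 0"
    obtain d0 where d0: "d0 > 0" "\<And>x. x \<in> {0..1} \<Longrightarrow> dist x 0 < d0 \<Longrightarrow> dist (?f x) (?f 0) < e / 4"
      using fc[unfolded continuous_on_iff, rule_format, of 0 "e / 4"] e by auto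
    obtain d1 where d1: "d1 > 0" "\<And>x. x \<in> {0..1} \<Longrightarrow> dist x 1 < d1 \<Longrightarrow> dist (?f x) (?f 1) < e / 4"
      using fc[unfolded continuous_on_iff, rule_format, of 1 "e / 4"] e by auto
    \<comment> \<open>From \<open>k = m\<close> on, the boundary strips of width \<open>2 / k\<close> lie where the representative is small.\<close>
    obtain m :: nat where m: "2 / min d0 d1 < real m" using reals_Archimedean2 by blast
    have "norm (integral\<^sup>L unit_measure (\<lambda>x. ?f x * cutoff_deriv (real k) x) - 0) < e" if "k \<ge> m" for k
    proof -
      let ?w = "\<lambda>x. real k * hat (real k * x - 1) + real k * hat (real k * (1 - x) - 1)"
      have kd: "2 < real k * d0" "2 < real k * d1"
      proof -
        have "2 / min d0 d1 < real k" using m that by linarith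
        then have "2 < real k * min d0 d1" using d0(1) d1(1) by (simp add: divide_less_eq)
        also have "real k * min d0 d1 \<le> real k * d0" by (intro mult_left_mono) auto
        finally show "2 < real k * d0" .
        have "2 < real k * min d0 d1" by fact
        also have "real k * min d0 d1 \<le> real k * d1" by (intro mult_left_mono) auto
        finally show "2 < real k * d1" .
      qed
      have bound: "\<bar>?f x * cutoff_deriv (real k) x\<bar> \<le> e / 4 * ?w x" if x: "x \<in> {0<..<1}" for x
      proof (cases "x < d0 \<or> 1 - x < d1")
        case True
        then have "\<bar>?f x\<bar> \<le> e / 4"
          using d0(2)[of x] d1(2)[of x] x g(3,4) by (auto simp: dist_real_def)
        then show ?thesis
          unfolding abs_mult[of "?f x"] using e
          by (intro mult_mono abs_cutoff_deriv_le) auto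
      next
        case False
        then have "real k * d0 \<le> real k * x" "real k * d1 \<le> real k * (1 - x)"
          by (auto intro: mult_left_mono)
        then have "?w x = 0" using kd by (simp add: hat_eq_0)
        moreover have "\<bar>cutoff_deriv (real k) x\<bar> \<le> ?w x" by (rule abs_cutoff_deriv_le) simp
        ultimately show ?thesis by simp
      qed
      have wc: "continuous_on {0..1} ?w" by (intro continuous_intros)
      have "norm (integral\<^sup>L unit_measure (\<lambda>x. ?f x * cutoff_deriv (real k) x))
          \<le> integral\<^sup>L unit_measure (\<lambda>x. norm (?f x * cutoff_deriv (real k) x))"
        by (rule Bochner_Integration.integral_norm_bound)
      also have "\<dots> \<le> integral\<^sup>L unit_measure (\<lambda>x. e / 4 * ?w x)"
        by (rule integral_mono)
          (use bound wc fc in \<open>auto intro!: integral_unit_measure_continuous continuous_intros continuous_on_cutoff simp del: distrib_left_numeral\<close>)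
      also have "\<dots> = e / 4 * integral\<^sup>L unit_measure ?w"
        by (rule Bochner_Integration.integral_mult_right) (intro integral_unit_measure_continuous wc)
      also have "\<dots> \<le> e / 4 * 2"
        using e by (intro mult_left_mono integral_hat_sum_le) auto
      also have "\<dots> < e" using e by simp
      finally show ?thesis by simp
    qed
    then show "\<exists>m. \<forall>k\<ge>m. norm (integral\<^sup>L unit_measure (\<lambda>x. ?f x * cutoff_deriv (real k) x) - 0) < e"
      by blast
  qed
  moreover have "inner u (to_L2 (\<lambda>x. p x * cutoff_deriv (real k) x))
      = integral\<^sup>L unit_measure (\<lambda>x. ?f x * cutoff_deriv (real k) x)" for k
    unfolding g(2) using g(1) pc
    by (subst inner_to_L2)
      (auto intro!: square_integrable_continuous continuous_intros continuous_on_cutoff simp: mult.assoc)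
  ultimately show ?thesis by simp
qed

text \<open>
  Two integrations by parts. The first one pairs with a sine, which vanishes at both ends; the second
  pairs with a cosine and needs the Neumann condition on \<open>v\<close>, the first derivative of \<open>u\<close>.
\<close>

lemma coef_second_deriv:
  assumes "weak_deriv u v" "weak_deriv v w" "boundary_value v 0 0" "boundary_value v 1 0"
  shows "coef w n = - lam n * coef u n"
proof -
  let ?s = "\<lambda>x. sin (real n * pi * x)"
  have ssq: "square_integrable ?s" "square_integrable (cosine n)"
    by (auto intro!: square_integrable_continuous continuous_intros)
  have "inner u (to_L2 (\<lambda>x. (real n * pi) * cosine n x)) = - inner v (to_L2 ?s)"
  proof (rule weak_deriv_by_parts[OF assms(1)])
    show D: "(?s has_real_derivative (real n * pi) * cosine n x) (at x)" for x
      by (auto intro!: derivative_eq_intros)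
    show "(\<lambda>k. inner u (to_L2 (\<lambda>x. ?s x * cutoff_deriv (real k) x))) \<longlonglongrightarrow> 0"
      by (rule inner_cutoff_deriv_vanishing_test[OF D])
        (auto intro!: continuous_intros simp: sin_zero_iff_int2)
  qed (auto intro!: continuous_intros)
  moreover have "inner v (to_L2 (\<lambda>x. - (real n * pi) * ?s x)) = - inner w (to_L2 (cosine n))"
    by (rule weak_deriv_by_parts[OF assms(2)])
      (auto intro!: derivative_eq_intros continuous_intros
        inner_cutoff_deriv_vanishing_boundary assms(3,4))
  ultimately have h: "real n * pi * inner u (to_L2 (cosine n)) = - inner v (to_L2 ?s)"
    "- (real n * pi) * inner v (to_L2 ?s) = - inner w (to_L2 (cosine n))"
    unfolding to_L2_scale[OF ssq(1)] to_L2_scale[OF ssq(2)] inner_scaleR_right .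
  have "inner w (to_L2 (cosine n)) = - ((real n)\<^sup>2 * pi\<^sup>2) * inner u (to_L2 (cosine n))"
  proof -
    have "inner w (to_L2 (cosine n)) = real n * pi * inner v (to_L2 ?s)"
      using h(2) by simp
    also have "inner v (to_L2 ?s) = - (real n * pi * inner u (to_L2 (cosine n)))"
      using h(1) by linarith
    finally show ?thesis by (simp add: power2_eq_square)
  qed
  then show ?thesis by (simp add: coef_def phi_eq lam_def)
qed

lemma coef_Dx_state_space:
  assumes "u \<in> state_space"
  shows "coef ((Dx ^^ 2) u) n = - lam n * coef u n"
    and "coef ((Dx ^^ 4) u) n = (lam n)\<^sup>2 * coef u n"
proof -
  have S: "u \<in> Sobolev (Suc (Suc (Suc (Suc 0))))"
    using assms by (simp add: state_space_def numeral_eq_Suc)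
  have W: "weak_deriv u (Dx u)" "weak_deriv (Dx u) (Dx (Dx u))"
    "weak_deriv (Dx (Dx u)) (Dx (Dx (Dx u)))" "weak_deriv (Dx (Dx (Dx u))) (Dx (Dx (Dx (Dx u))))"
  proof -
    have "Dx u \<in> Sobolev (Suc (Suc (Suc 0)))" "Dx (Dx u) \<in> Sobolev (Suc (Suc 0))"
      "Dx (Dx (Dx u)) \<in> Sobolev (Suc 0)"
      using S by simp_all
    with S show "weak_deriv u (Dx u)" "weak_deriv (Dx u) (Dx (Dx u))"
      "weak_deriv (Dx (Dx u)) (Dx (Dx (Dx u)))" "weak_deriv (Dx (Dx (Dx u))) (Dx (Dx (Dx (Dx u))))"
      using weak_deriv_Dx by blast+
  qed
  have iter: "(Dx ^^ 2) u = Dx (Dx u)" "(Dx ^^ 3) u = Dx (Dx (Dx u))"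
    "(Dx ^^ 4) u = Dx (Dx (Dx (Dx u)))"
    by (simp_all add: numeral_eq_Suc)
  have B: "boundary_value (Dx u) 0 0" "boundary_value (Dx u) 1 0"
    "boundary_value (Dx (Dx (Dx u))) 0 0" "boundary_value (Dx (Dx (Dx u))) 1 0"
    using assms unfolding state_space_def by (simp_all add: iter)
  show 2: "coef ((Dx ^^ 2) u) n = - lam n * coef u n"
    unfolding iter by (rule coef_second_deriv[OF W(1,2) B(1,2)])
  show "coef ((Dx ^^ 4) u) n = (lam n)\<^sup>2 * coef u n"
    using coef_second_deriv[OF W(3,4) B(3,4), of n] 2 unfolding iter by (simp add: power2_eq_square)
qed

section \<open>The induced norm and the matrix exponential\<close>

lemma mult_mat_vec_index:
  assumes "A \<in> carrier_mat m n" "i < m"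
  shows "vec_index (A *\<^sub>v Matrix.vec n x) i = (\<Sum>j<n. A $$ (i, j) * x j)"
  using assms by (auto simp: scalar_prod_def atLeast0LessThan intro!: sum.cong)

lemma vec_norm_mult_mat_vec:
  assumes "A \<in> carrier_mat m n"
  shows "vec_norm (A *\<^sub>v Matrix.vec n x) = L2_set (\<lambda>i. \<Sum>j<n. A $$ (i, j) * x j) {..<m}"
proof -
  have "dim_vec (A *\<^sub>v Matrix.vec n x) = m" using assms by simp
  then show ?thesis
    unfolding vec_norm_def using assms
    by (intro L2_set_cong) (auto simp only: mult_mat_vec_index lessThan_iff)
qed

text \<open>
  The supremum of a set of reals that is not bounded above is unspecified, so boundedness is what makes
  \<open>induced_norm\<close> an upper bound.
\<close>

lemma bdd_above_induced_norm:
  assumes "A \<in> carrier_mat m n"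
  shows "bdd_above {vec_norm (A *\<^sub>v v) | v. v \<in> carrier_vec (dim_col A) \<and> vec_norm v \<le> 1}"
proof (rule bdd_aboveI)
  fix y assume "y \<in> {vec_norm (A *\<^sub>v v) | v. v \<in> carrier_vec (dim_col A) \<and> vec_norm v \<le> 1}"
  then obtain v where v: "y = vec_norm (A *\<^sub>v v)" "v \<in> carrier_vec n" "vec_norm v \<le> 1"
    using assms by auto
  have dv: "dim_vec v = n" using v(2) by simp
  have comp: "\<bar>vec_index v j\<bar> \<le> 1" if "j < n" for j
  proof -
    have "\<bar>vec_index v j\<bar> \<le> L2_set (\<lambda>j. \<bar>vec_index v j\<bar>) {..<n}"
      using that by (intro member_le_L2_set) auto
    also have "\<dots> = vec_norm v" by (simp add: vec_norm_def dv L2_set_def)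
    finally show ?thesis using v(3) by simp
  qed
  have "v = Matrix.vec n (vec_index v)" using dv by auto
  then have "y = L2_set (\<lambda>i. \<Sum>j<n. A $$ (i, j) * vec_index v j) {..<m}"
    using vec_norm_mult_mat_vec[OF assms, of "vec_index v"] v(1) by simp
  also have "\<dots> \<le> (\<Sum>i<m. \<bar>\<Sum>j<n. A $$ (i, j) * vec_index v j\<bar>)"
    by (rule L2_set_le_sum_abs)
  also have "\<dots> \<le> (\<Sum>i<m. \<Sum>j<n. \<bar>A $$ (i, j)\<bar>)"
  proof (rule sum_mono)
    fix i
    have "\<bar>\<Sum>j<n. A $$ (i, j) * vec_index v j\<bar> \<le> (\<Sum>j<n. \<bar>A $$ (i, j) * vec_index v j\<bar>)"
      by (rule sum_abs)
    also have "\<dots> \<le> (\<Sum>j<n. \<bar>A $$ (i, j)\<bar>)"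
      using comp by (intro sum_mono) (auto simp: abs_mult mult_left_le)
    finally show "\<bar>\<Sum>j<n. A $$ (i, j) * vec_index v j\<bar> \<le> (\<Sum>j<n. \<bar>A $$ (i, j)\<bar>)" .
  qed
  finally show "y \<le> (\<Sum>i<m. \<Sum>j<n. \<bar>A $$ (i, j)\<bar>)" .
qed

text \<open>
  Stated with entries and functions on indices, the form in which the differential equations below
  are written.
\<close>

lemma induced_norm_bound:
  assumes "A \<in> carrier_mat m n"
  shows "L2_set (\<lambda>i. \<Sum>j<n. A $$ (i, j) * x j) {..<m} \<le> induced_norm A * L2_set x {..<n}"
proof (cases "L2_set x {..<n} = 0")
  case True
  then have "x j = 0" if "j < n" for j
    using that by (simp add: L2_set_eq_0_iff)
  then have "L2_set (\<lambda>i. \<Sum>j<n. A $$ (i, j) * x j) {..<m} = L2_set (\<lambda>i. 0) {..<m}"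
    by (intro L2_set_cong) auto
  then show ?thesis using True by (simp add: L2_set_0')
next
  case False
  define c where "c = L2_set x {..<n}"
  have c: "c > 0" using False L2_set_nonneg[of x "{..<n}"] by (simp add: c_def less_le)
  let ?v = "Matrix.vec n (\<lambda>j. inverse c * x j)"
  have "vec_norm ?v = L2_set (\<lambda>j. inverse c * x j) {..<n}"
    unfolding vec_norm_def by (intro L2_set_cong) auto
  also have "\<dots> = inverse c * c"
    using c by (simp add: L2_set_right_distrib[symmetric] c_def)
  finally have "vec_norm ?v = 1" using c by simp
  then have "vec_norm (A *\<^sub>v ?v) \<le> induced_norm A"
    unfolding induced_norm_def using assms
    by (intro cSup_upper bdd_above_induced_norm[OF assms]) (auto intro!: exI[of _ ?v])
  also have "vec_norm (A *\<^sub>v ?v) = L2_set (\<lambda>i. \<Sum>j<n. A $$ (i, j) * (inverse c * x j)) {..<m}"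
    by (rule vec_norm_mult_mat_vec[OF assms])
  also have "\<dots> = L2_set (\<lambda>i. inverse c * (\<Sum>j<n. A $$ (i, j) * x j)) {..<m}"
    by (intro L2_set_cong) (auto simp: sum_distrib_left mult_ac intro!: sum.cong)
  also have "\<dots> = inverse c * L2_set (\<lambda>i. \<Sum>j<n. A $$ (i, j) * x j) {..<m}"
    using c by (intro L2_set_right_distrib[symmetric]) simp
  finally show ?thesis
    using c unfolding c_def[symmetric] by (simp add: field_simps)
qed

lemma induced_norm_nonneg:
  assumes "A \<in> carrier_mat m n" "n > 0"
  shows "0 \<le> induced_norm A"
proof -
  have "L2_set (\<lambda>_. 1::real) {..<n} > 0"
    using assms(2) by (simp add: L2_set_constant)
  moreover have "0 \<le> induced_norm A * L2_set (\<lambda>_. 1) {..<n}"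
    using induced_norm_bound[OF assms(1), of "\<lambda>_. 1"] L2_set_nonneg order_trans by blast
  ultimately show ?thesis by (simp add: zero_le_mult_iff)
qed

lemma abs_sum_mult_le_L2_set: "\<bar>\<Sum>i\<in>I. a i * b i\<bar> \<le> L2_set a I * L2_set b I"
proof -
  have "\<bar>\<Sum>i\<in>I. a i * b i\<bar> \<le> (\<Sum>i\<in>I. \<bar>a i\<bar> * \<bar>b i\<bar>)"
    using sum_abs[of "\<lambda>i. a i * b i" I] by (simp add: abs_mult)
  also have "\<dots> \<le> L2_set a I * L2_set b I" by (rule L2_set_mult_ineq)
  finally show ?thesis .
qed

lemma pow_mat_smult:
  fixes F :: "real mat"
  assumes "F \<in> carrier_mat n n"
  shows "(t \<cdot>\<^sub>m F) ^\<^sub>m k = t ^ k \<cdot>\<^sub>m (F ^\<^sub>m k)"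
proof (induction k)
  case 0
  show ?case using assms by (intro eq_matI) auto
next
  case (Suc k)
  have P: "F ^\<^sub>m k \<in> carrier_mat n n" using assms by (rule pow_carrier_mat)
  have "(t \<cdot>\<^sub>m F) ^\<^sub>m Suc k = (t ^ k \<cdot>\<^sub>m (F ^\<^sub>m k)) * (t \<cdot>\<^sub>m F)"
    using Suc.IH by simp
  also have "\<dots> = t ^ k \<cdot>\<^sub>m (t \<cdot>\<^sub>m (F ^\<^sub>m k * F))"
    using assms mult_smult_assoc_mat[OF P, of "t \<cdot>\<^sub>m F" n] mult_smult_distrib[OF P assms] by simp
  also have "\<dots> = t ^ Suc k \<cdot>\<^sub>m (F ^\<^sub>m Suc k)"
    by (intro eq_matI) auto
  finally show ?case .
qed

text \<open>
  The entries of the matrix exponential as everywhere convergent power series in time, which can be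
  differentiated term by term.
\<close>

definition exp_entry :: "real mat \<Rightarrow> nat \<Rightarrow> nat \<Rightarrow> real \<Rightarrow> real" where
  "exp_entry F i j t = (\<Sum>k. (F ^\<^sub>m k) $$ (i, j) / fact k * t ^ k)"

lemma mat_exp_smult_entry:
  assumes "F \<in> carrier_mat n n" "i < n" "j < n"
  shows "mat_exp (t \<cdot>\<^sub>m F) $$ (i, j) = exp_entry F i j t"
proof -
  have "((t \<cdot>\<^sub>m F) ^\<^sub>m k) $$ (i, j) / fact k = (F ^\<^sub>m k) $$ (i, j) / fact k * t ^ k" for k
    using assms pow_carrier_mat[OF assms(1), of k] by (simp add: pow_mat_smult)
  then show ?thesis
    using assms by (simp add: mat_exp_def exp_entry_def)
qed

lemma pow_mat_Suc_entry:
  fixes F :: "real mat"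
  assumes "F \<in> carrier_mat n n" "i < n" "j < n"
  shows "(F ^\<^sub>m Suc k) $$ (i, j) = (\<Sum>l<n. (F ^\<^sub>m k) $$ (i, l) * F $$ (l, j))"
  using assms pow_carrier_mat[OF assms(1), of k]
  by (auto simp: scalar_prod_def atLeast0LessThan intro!: sum.cong)

text \<open>
  The sum \<open>s\<close> of all absolute values of entries of \<open>F\<close> is submultiplicative, so the powers of \<open>F\<close> have
  entries of size at most \<open>s ^ k\<close>.
\<close>

lemma summable_exp_entry:
  fixes F :: "real mat"
  assumes "F \<in> carrier_mat n n" "i < n" "j < n"
  shows "summable (\<lambda>k. (F ^\<^sub>m k) $$ (i, j) / fact k * t ^ k)"
proof -
  define s where "s = (\<Sum>l<n. \<Sum>j<n. \<bar>F $$ (l, j)\<bar>)"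
  have s0: "0 \<le> s" by (auto simp: s_def intro!: sum_nonneg)
  have bound: "\<bar>(F ^\<^sub>m k) $$ (i, j)\<bar> \<le> s ^ k" if "j < n" for k j
    using that
  proof (induction k arbitrary: j)
    case 0
    then show ?case using assms by auto
  next
    case (Suc k)
    have "\<bar>(F ^\<^sub>m Suc k) $$ (i, j)\<bar> \<le> (\<Sum>l<n. \<bar>(F ^\<^sub>m k) $$ (i, l) * F $$ (l, j)\<bar>)"
      unfolding pow_mat_Suc_entry[OF assms(1,2) Suc.prems] by (rule sum_abs)
    also have "\<dots> \<le> (\<Sum>l<n. s ^ k * (\<Sum>j<n. \<bar>F $$ (l, j)\<bar>))"
      unfolding abs_mult using Suc s0
      by (intro sum_mono mult_mono Suc.IH member_le_sum[of j "{..<n}"]) auto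
    also have "\<dots> = s ^ k * s" unfolding s_def by (rule sum_distrib_left[symmetric])
    also have "\<dots> = s ^ Suc k" by simp
    finally show ?case .
  qed
  have "summable (\<lambda>k. inverse (fact k) * (s * \<bar>t\<bar>) ^ k)" by (rule summable_exp)
  then show ?thesis
  proof (rule summable_comparison_test'[where N = 0])
    fix k
    have "norm ((F ^\<^sub>m k) $$ (i, j) / fact k * t ^ k)
        = \<bar>(F ^\<^sub>m k) $$ (i, j)\<bar> * (inverse (fact k) * \<bar>t\<bar> ^ k)"
      by (simp add: abs_mult power_abs divide_inverse)
    also have "\<dots> \<le> s ^ k * (inverse (fact k) * \<bar>t\<bar> ^ k)"
      using bound[OF assms(3)] by (intro mult_right_mono) auto
    finally show "norm ((F ^\<^sub>m k) $$ (i, j) / fact k * t ^ k) \<le> inverse (fact k) * (s * \<bar>t\<bar>) ^ k"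
      by (simp add: power_mult_distrib mult_ac)
  qed
qed

lemma exp_entry_0:
  assumes "F \<in> carrier_mat n n" "i < n" "j < n"
  shows "exp_entry F i j 0 = (if i = j then 1 else 0)"
  using assms powser_zero[of "\<lambda>k. (F ^\<^sub>m k) $$ (i, j) / fact k"] by (simp add: exp_entry_def)

lemma DERIV_exp_entry:
  assumes "F \<in> carrier_mat n n" "i < n" "j < n"
  shows "(exp_entry F i j has_real_derivative (\<Sum>l<n. exp_entry F i l t * F $$ (l, j))) (at t)"
proof -
  let ?c = "\<lambda>k. (F ^\<^sub>m k) $$ (i, j) / fact k"
  have "((\<lambda>x. \<Sum>k. ?c k * x ^ k) has_real_derivative (\<Sum>k. diffs ?c k * t ^ k)) (at t)"
    by (rule termdiffs_strong_converges_everywhere) (rule summable_exp_entry[OF assms])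
  moreover have "diffs ?c k * t ^ k
      = (\<Sum>l<n. (F ^\<^sub>m k) $$ (i, l) / fact k * t ^ k * F $$ (l, j))" for k
  proof -
    have "diffs ?c k = (F ^\<^sub>m Suc k) $$ (i, j) / fact k"
      by (simp add: diffs_def divide_simps del: pow_mat.simps)
    then show ?thesis
      unfolding pow_mat_Suc_entry[OF assms] by (simp add: sum_divide_distrib sum_distrib_left mult_ac)
  qed
  moreover have "(\<Sum>k. \<Sum>l<n. (F ^\<^sub>m k) $$ (i, l) / fact k * t ^ k * F $$ (l, j))
      = (\<Sum>l<n. exp_entry F i l t * F $$ (l, j))"
  proof -
    have sm: "summable (\<lambda>k. (F ^\<^sub>m k) $$ (i, l) / fact k * t ^ k)" if "l \<in> {..<n}" for l
      using summable_exp_entry[OF assms(1,2)] that by simp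
    have "(\<Sum>k. \<Sum>l<n. (F ^\<^sub>m k) $$ (i, l) / fact k * t ^ k * F $$ (l, j))
        = (\<Sum>l<n. \<Sum>k. (F ^\<^sub>m k) $$ (i, l) / fact k * t ^ k * F $$ (l, j))"
      by (rule suminf_sum) (rule summable_mult2[OF sm])
    also have "\<dots> = (\<Sum>l<n. exp_entry F i l t * F $$ (l, j))"
      unfolding exp_entry_def by (intro sum.cong refl suminf_mult2[symmetric] sm)
    finally show ?thesis .
  qed
  ultimately show ?thesis by (simp add: exp_entry_def[abs_def])
qed

section \<open>Estimates for linear differential equations\<close>

text \<open>
  Variation of constants for \<open>z' = F z + g\<close>, with finitely many exceptional times. The vector-valued
  integral is avoided by pairing with the fixed vector \<open>a = z T\<close>: the scalar function
  \<open>a \<bullet> exp ((T - s) F) z s\<close> has derivative \<open>a \<bullet> exp ((T - s) F) g s\<close>, equals \<open>|a|\<^sup>2\<close> at \<open>s = T\<close>, and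
  dividing by \<open>|a|\<close> gives the bound. The rates \<open>\<sigma> < \<omega>\<close> combine to the integral of
  \<open>exp ((\<omega> - \<sigma>) s)\<close>, which produces the factor \<open>1 / (\<omega> - \<sigma>)\<close>.
\<close>

lemma exp_forcing_bound:
  fixes z g :: "real \<Rightarrow> nat \<Rightarrow> real"
  assumes F: "F \<in> carrier_mat n n"
    and norm_exp: "\<And>t. 0 \<le> t \<Longrightarrow> induced_norm (mat_exp (t \<cdot>\<^sub>m F)) \<le> R * exp (- \<omega> * t)"
    and "0 \<le> R" "\<sigma> < \<omega>" "0 \<le> T" "finite S"
    and cont: "\<And>i. i < n \<Longrightarrow> continuous_on {0..T} (\<lambda>t. z t i)"
    and deriv: "\<And>i t. i < n \<Longrightarrow> t \<in> {0<..<T} - S \<Longrightarrow>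
      ((\<lambda>t. z t i) has_real_derivative (\<Sum>j<n. F $$ (i, j) * z t j) + g t i) (at t)"
    and g: "\<And>t. t \<in> {0..T} \<Longrightarrow> L2_set (g t) {..<n} \<le> G * exp (- \<sigma> * t)"
    and "0 \<le> G"
  shows "L2_set (z T) {..<n} \<le> exp (- \<sigma> * T) * (R * L2_set (z 0) {..<n} + R * G / (\<omega> - \<sigma>))"
proof -
  define a where "a = z T"
  define B where "B t x = (\<Sum>i<n. a i * (\<Sum>j<n. exp_entry F i j t * x j))" for t and x :: "nat \<Rightarrow> real"
  have B_bound: "\<bar>B t x\<bar> \<le> L2_set a {..<n} * (R * exp (- \<omega> * t) * L2_set x {..<n})" if "0 \<le> t" for t x
  proof -
    have E: "mat_exp (t \<cdot>\<^sub>m F) \<in> carrier_mat n n"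
      using F by (simp add: mat_exp_def)
    have "\<bar>B t x\<bar> \<le> L2_set a {..<n} * L2_set (\<lambda>i. \<Sum>j<n. exp_entry F i j t * x j) {..<n}"
      unfolding B_def by (rule abs_sum_mult_le_L2_set)
    also have "L2_set (\<lambda>i. \<Sum>j<n. exp_entry F i j t * x j) {..<n}
        = L2_set (\<lambda>i. \<Sum>j<n. mat_exp (t \<cdot>\<^sub>m F) $$ (i, j) * x j) {..<n}"
      by (intro L2_set_cong refl sum.cong) (simp add: mat_exp_smult_entry[OF F])
    also have "L2_set a {..<n} * \<dots> \<le> L2_set a {..<n} * (induced_norm (mat_exp (t \<cdot>\<^sub>m F)) * L2_set x {..<n})"
      by (intro mult_left_mono induced_norm_bound[OF E]) simp
    also have "\<dots> \<le> L2_set a {..<n} * (R * exp (- \<omega> * t) * L2_set x {..<n})"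
      by (intro mult_left_mono mult_right_mono norm_exp that) auto
    finally show ?thesis .
  qed
  define y where "y s = B (T - s) (z s)" for s
  have y_deriv: "(y has_real_derivative B (T - s) (g s)) (at s)" if s: "s \<in> {0<..<T} - S" for s
  proof -
    have E: "((\<lambda>s. exp_entry F i j (T - s)) has_real_derivative
        - (\<Sum>l<n. exp_entry F i l (T - s) * F $$ (l, j))) (at s)" if "i < n" "j < n" for i j
    proof -
      have "((\<lambda>s. T - s) has_real_derivative - 1) (at s)"
        by (auto intro!: derivative_eq_intros)
      from DERIV_chain2[OF DERIV_exp_entry[OF F that] this] show ?thesis by simp
    qed
    have "(y has_real_derivative (\<Sum>i<n. a i * (\<Sum>j<n.
        - (\<Sum>l<n. exp_entry F i l (T - s) * F $$ (l, j)) * z s j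
        + exp_entry F i j (T - s) * ((\<Sum>l<n. F $$ (j, l) * z s l) + g s j)))) (at s)"
      unfolding y_def[abs_def] B_def
    proof (intro DERIV_sum DERIV_cmult)
      fix i j assume "i \<in> {..<n}" "j \<in> {..<n}"
      then have "i < n" "j < n" by auto
      from DERIV_mult[OF E[OF this] deriv[OF this(2) s]]
      show "((\<lambda>s. exp_entry F i j (T - s) * z s j) has_real_derivative
          - (\<Sum>l<n. exp_entry F i l (T - s) * F $$ (l, j)) * z s j
          + exp_entry F i j (T - s) * ((\<Sum>l<n. F $$ (j, l) * z s l) + g s j)) (at s)"
        by (simp add: mult.commute)
    qed
    moreover have "(\<Sum>j<n. - (\<Sum>l<n. exp_entry F i l (T - s) * F $$ (l, j)) * z s j
        + exp_entry F i j (T - s) * ((\<Sum>l<n. F $$ (j, l) * z s l) + g s j))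
      = (\<Sum>j<n. exp_entry F i j (T - s) * g s j)" for i
    proof -
      have "(\<Sum>j<n. (\<Sum>l<n. exp_entry F i l (T - s) * F $$ (l, j)) * z s j)
          = (\<Sum>j<n. \<Sum>l<n. exp_entry F i l (T - s) * F $$ (l, j) * z s j)"
        by (simp add: sum_distrib_right)
      also have "\<dots> = (\<Sum>l<n. \<Sum>j<n. exp_entry F i l (T - s) * F $$ (l, j) * z s j)"
        by (rule sum.swap)
      also have "\<dots> = (\<Sum>l<n. exp_entry F i l (T - s) * (\<Sum>j<n. F $$ (l, j) * z s j))"
        by (simp add: sum_distrib_left mult.assoc)
      finally show ?thesis
        by (simp add: sum.distrib sum_subtractf distrib_left)
    qed
    ultimately show ?thesis by (simp add: B_def)
  qed
  have y_cont: "continuous_on {0..T} y"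
    unfolding y_def B_def
  proof (intro continuous_intros cont)
    fix i j assume "i \<in> {..<n}" "j \<in> {..<n}"
    then have "continuous_on UNIV (exp_entry F i j)"
      by (intro continuous_at_imp_continuous_on ballI DERIV_isCont[OF DERIV_exp_entry[OF F]]) auto
    then show "continuous_on {0..T} (\<lambda>s. exp_entry F i j (T - s))"
      by (rule continuous_on_compose2) (auto intro!: continuous_intros)
  qed auto
  have int: "((\<lambda>s. B (T - s) (g s)) has_integral (y T - y 0)) {0..T}"
    using assms(5,6) y_cont y_deriv
    by (intro fundamental_theorem_of_calculus_interior_strong[OF assms(6)])
      (auto simp: has_real_derivative_iff_has_vector_derivative)
  define A where "A = L2_set a {..<n}"
  \<comment> \<open>\<open>?h\<close> dominates the integrand and has an explicit primitive.\<close>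
  define K where "K = A * R * G * exp (- \<omega> * T)"
  have K: "0 \<le> K" "0 \<le> A" using assms(3,10) by (auto simp: K_def A_def)
  let ?h = "\<lambda>s. K * exp ((\<omega> - \<sigma>) * s)"
  have int_h: "(?h has_integral (K * exp ((\<omega> - \<sigma>) * T) / (\<omega> - \<sigma>)
      - K * exp ((\<omega> - \<sigma>) * 0) / (\<omega> - \<sigma>))) {0..T}"
    using assms(4,5)
    by (intro fundamental_theorem_of_calculus)
      (auto intro!: derivative_eq_intros simp flip: has_real_derivative_iff_has_vector_derivative)
  have "norm (B (T - s) (g s)) \<le> ?h s" if "s \<in> {0..T}" for s
  proof -
    have "\<bar>B (T - s) (g s)\<bar> \<le> A * (R * exp (- \<omega> * (T - s)) * L2_set (g s) {..<n})"
      unfolding A_def using that by (intro B_bound) auto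
    also have "\<dots> \<le> A * (R * exp (- \<omega> * (T - s)) * (G * exp (- \<sigma> * s)))"
      using assms(3) K by (intro mult_left_mono g that) auto
    also have "\<dots> = A * R * G * (exp (- \<omega> * (T - s)) * exp (- \<sigma> * s))" by simp
    also have "exp (- \<omega> * (T - s)) * exp (- \<sigma> * s) = exp (- \<omega> * T) * exp ((\<omega> - \<sigma>) * s)"
      by (simp add: algebra_simps flip: exp_add)
    finally show ?thesis by (simp add: K_def mult.assoc)
  qed
  then have "norm (integral {0..T} (\<lambda>s. B (T - s) (g s))) \<le> integral {0..T} ?h"
    using int int_h by (intro Henstock_Kurzweil_Integration.integral_norm_bound_integral) auto
  then have "\<bar>y T - y 0\<bar> \<le> (K * exp ((\<omega> - \<sigma>) * T) - K) / (\<omega> - \<sigma>)"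
    using integral_unique[OF int] integral_unique[OF int_h] by (simp add: diff_divide_distrib)
  also have "\<dots> \<le> K * exp ((\<omega> - \<sigma>) * T) / (\<omega> - \<sigma>)"
    using assms(4) K by (intro divide_right_mono) auto
  also have "\<dots> = A * (exp (- \<sigma> * T) * (R * G / (\<omega> - \<sigma>)))"
  proof -
    have "exp (- \<omega> * T) * exp ((\<omega> - \<sigma>) * T) = exp (- \<sigma> * T)"
      by (simp add: algebra_simps flip: exp_add)
    then show ?thesis unfolding K_def by (simp add: mult_ac)
  qed
  finally have yT: "\<bar>y T - y 0\<bar> \<le> A * (exp (- \<sigma> * T) * (R * G / (\<omega> - \<sigma>)))" .
  have "y T = A\<^sup>2"
  proof -
    have "y T = (\<Sum>i<n. a i * (\<Sum>j<n. (if i = j then a j else 0)))"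
      unfolding y_def B_def
      by (intro sum.cong refl arg_cong2[where f = "(*)"]) (simp add: exp_entry_0[OF F] a_def)
    also have "\<dots> = (\<Sum>i<n. (a i)\<^sup>2)"
      by (intro sum.cong) (auto simp: power2_eq_square)
    also have "\<dots> = A\<^sup>2" by (simp add: A_def L2_set_def sum_nonneg)
    finally show ?thesis .
  qed
  moreover have "\<bar>y 0\<bar> \<le> A * (exp (- \<sigma> * T) * (R * L2_set (z 0) {..<n}))"
  proof -
    have "\<bar>y 0\<bar> \<le> A * (R * exp (- \<omega> * T) * L2_set (z 0) {..<n})"
      unfolding y_def A_def using B_bound[of T "z 0"] assms(5) by simp
    also have "\<dots> \<le> A * (R * exp (- \<sigma> * T) * L2_set (z 0) {..<n})"
      using assms(3,4,5) K
      by (intro mult_left_mono mult_right_mono) (auto simp: mult_right_mono)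
    finally show ?thesis by (simp add: mult_ac)
  qed
  ultimately have "A * A \<le> A * (exp (- \<sigma> * T) * (R * L2_set (z 0) {..<n} + R * G / (\<omega> - \<sigma>)))"
    using yT by (simp add: power2_eq_square distrib_left)
  moreover have "0 \<le> exp (- \<sigma> * T) * (R * L2_set (z 0) {..<n} + R * G / (\<omega> - \<sigma>))"
    using assms(3,4,10) by auto
  ultimately have "A \<le> exp (- \<sigma> * T) * (R * L2_set (z 0) {..<n} + R * G / (\<omega> - \<sigma>))"
    using K(2) by (cases "A = 0") auto
  then show ?thesis by (simp add: A_def a_def)
qed

text \<open>
  The bound for one sampling interval. The integrating factor \<open>exp (r (s - a))\<close> removes \<open>- r d\<close>;
  undoing it costs \<open>exp (- r (t - a))\<close>, which is at most \<open>exp (max 0 (- r) T)\<close> for either sign of \<open>r\<close>.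
\<close>

lemma predictor_bound:
  fixes d k :: "real \<Rightarrow> real"
  assumes "a \<le> t" "t \<le> a + T" "continuous_on {a..t} d"
    and deriv: "\<And>s. s \<in> {a<..<t} \<Longrightarrow> (d has_real_derivative k s - r * d s) (at s)"
    and k: "\<And>s. s \<in> {a..t} \<Longrightarrow> \<bar>k s\<bar> \<le> B"
  shows "\<bar>d t\<bar> \<le> exp (max 0 (- r) * T) * (\<bar>d a\<bar> + B * integral {0..T} (\<lambda>s. exp (r * s)))"
proof -
  have B: "0 \<le> B" using k[of a] assms(1) by force
  let ?I = "\<lambda>x. integral {0..x} (\<lambda>s. exp (r * s))"
  let ?h = "\<lambda>s. exp (r * (s - a)) * d s"
  have int_exp: "(\<lambda>s. exp (r * s)) integrable_on {0..x}" for x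
    by (intro integrable_continuous_real continuous_intros)
  have int_h: "((\<lambda>s. exp (r * (s - a)) * k s) has_integral (?h t - ?h a)) {a..t}"
  proof (rule fundamental_theorem_of_calculus_interior[OF assms(1)])
    show "(?h has_vector_derivative exp (r * (s - a)) * k s) (at s)" if "s \<in> {a<..<t}" for s
      unfolding has_real_derivative_iff_has_vector_derivative[symmetric]
      by (auto intro!: derivative_eq_intros deriv[OF that] simp: algebra_simps)
  qed (intro continuous_intros assms(3))
  have int_g: "((\<lambda>s. B * exp (r * (s - a))) has_integral (B * ?I (t - a) - B * ?I (a - a))) {a..t}"
  proof (rule fundamental_theorem_of_calculus[OF assms(1)])
    fix s assume s: "s \<in> {a..t}"
    have "(?I has_real_derivative exp (r * (s - a))) (at (s - a) within {0..t - a})"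
      by (rule integral_has_real_derivative) (use s in \<open>auto intro!: continuous_intros\<close>)
    then have "((?I \<circ> (\<lambda>s. s - a)) has_real_derivative exp (r * (s - a)) * 1) (at s within {a..t})"
      by (intro DERIV_image_chain)
        (auto intro!: derivative_eq_intros intro: has_field_derivative_subset)
    then show "((\<lambda>s. B * ?I (s - a)) has_vector_derivative B * exp (r * (s - a))) (at s within {a..t})"
      unfolding has_real_derivative_iff_has_vector_derivative[symmetric]
      by (intro DERIV_cmult) (simp add: o_def)
  qed
  have "norm (integral {a..t} (\<lambda>s. exp (r * (s - a)) * k s)) \<le> integral {a..t} (\<lambda>s. B * exp (r * (s - a)))"
  proof (rule Henstock_Kurzweil_Integration.integral_norm_bound_integral)
    fix s assume "s \<in> {a..t}"
    from k[OF this] show "norm (exp (r * (s - a)) * k s) \<le> B * exp (r * (s - a))"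
      by (simp add: abs_mult mult.commute)
  qed (use int_h int_g in auto)
  then have "\<bar>?h t - d a\<bar> \<le> B * ?I (t - a)"
    unfolding integral_unique[OF int_h] integral_unique[OF int_g] by simp
  also have "\<dots> \<le> B * ?I T"
    using assms B int_exp by (intro mult_left_mono integral_subset_le) auto
  finally have h: "\<bar>?h t\<bar> \<le> \<bar>d a\<bar> + B * ?I T" by linarith
  have "d t = exp (- r * (t - a)) * ?h t"
    by (simp add: algebra_simps flip: exp_add mult.assoc) 
  then have "\<bar>d t\<bar> = exp (- r * (t - a)) * \<bar>?h t\<bar>"
    by (metis abs_mult abs_exp_cancel)
  also have "\<dots> \<le> exp (max 0 (- r) * T) * (\<bar>d a\<bar> + B * ?I T)"
  proof (rule mult_mono[OF _ h])
    have "- r * (t - a) \<le> max 0 (- r) * T"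
      using assms by (intro mult_mono) auto
    then show "exp (- r * (t - a)) \<le> exp (max 0 (- r) * T)" by simp
  qed auto
  finally show ?thesis .
qed

text \<open>
  Applied to the best constant \<open>P\<close> with \<open>p s \<le> P exp (- \<sigma> s)\<close> on the interval, the hypothesis gives
  \<open>P \<le> b + \<theta> P\<close>. The constant is finite and attained because \<open>p\<close> is continuous on a compact interval.
\<close>

lemma weighted_small_gain:
  fixes p :: "real \<Rightarrow> real"
  assumes "0 \<le> T" "continuous_on {0..T} p" "\<And>s. s \<in> {0..T} \<Longrightarrow> 0 \<le> p s" "\<theta> < 1"
    and gain: "\<And>P s. 0 \<le> P \<Longrightarrow> s \<in> {0..T} \<Longrightarrow>
      (\<And>\<tau>. \<tau> \<in> {0..s} \<Longrightarrow> p \<tau> \<le> P * exp (- \<sigma> * \<tau>)) \<Longrightarrow> p s \<le> exp (- \<sigma> * s) * (b + \<theta> * P)"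
  shows "p T \<le> exp (- \<sigma> * T) * (b / (1 - \<theta>))"
proof -
  let ?m = "\<lambda>s. p s * exp (\<sigma> * s)"
  have "continuous_on {0..T} ?m" by (intro continuous_intros assms(2))
  then obtain s0 where s0: "s0 \<in> {0..T}" "\<And>s. s \<in> {0..T} \<Longrightarrow> ?m s \<le> ?m s0"
    using continuous_attains_sup[of "{0..T}" ?m] assms(1) by auto
  define P where "P = ?m s0"
  have P0: "0 \<le> P" using assms(3)[OF s0(1)] by (simp add: P_def)
  have p_le: "p s \<le> P * exp (- \<sigma> * s)" if "s \<in> {0..T}" for s
  proof -
    have "?m s * exp (- \<sigma> * s) \<le> P * exp (- \<sigma> * s)"
      unfolding P_def by (intro mult_right_mono s0(2) that) simp
    then show ?thesis by (simp add: mult.assoc flip: exp_add)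
  qed
  have "p s0 \<le> exp (- \<sigma> * s0) * (b + \<theta> * P)"
    using s0(1) by (intro gain P0 p_le) auto
  then have "p s0 * exp (\<sigma> * s0) \<le> exp (- \<sigma> * s0) * (b + \<theta> * P) * exp (\<sigma> * s0)"
    by (intro mult_right_mono) auto
  also have "\<dots> = b + \<theta> * P"
    by (simp add: exp_minus field_simps)
  finally have "P \<le> b + \<theta> * P" unfolding P_def .
  then have "P \<le> b / (1 - \<theta>)"
    using assms(4) by (simp add: pos_le_divide_eq algebra_simps)
  then have "P * exp (- \<sigma> * T) \<le> b / (1 - \<theta>) * exp (- \<sigma> * T)"
    by (intro mult_right_mono) auto
  then show ?thesis using p_le[of T] assms(1) by (simp add: mult.commute)
qed

lemma homogeneous_linear_ode:
  fixes y :: "real \<Rightarrow> real"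
  assumes "0 \<le> T" "finite S" "continuous_on {0..T} y"
    and "\<And>t. t \<in> {0<..<T} - S \<Longrightarrow> (y has_real_derivative m * y t) (at t)"
  shows "y T = exp (m * T) * y 0"
proof -
  have "((\<lambda>t. 0) has_integral (exp (- m * T) * y T - exp (- m * 0) * y 0)) {0..T}"
  proof (rule fundamental_theorem_of_calculus_interior_strong[OF assms(2,1)])
    show "((\<lambda>t. exp (- m * t) * y t) has_vector_derivative 0) (at t)" if "t \<in> {0<..<T} - S" for t
      unfolding has_real_derivative_iff_has_vector_derivative[symmetric]
      by (auto intro!: derivative_eq_intros assms(4)[OF that])
  qed (intro continuous_intros assms(3))
  then have "exp (- m * T) * y T = y 0"
    using has_integral_unique has_integral_0 by fastforce
  then have "exp (m * T) * (exp (- m * T) * y T) = exp (m * T) * y 0" by simp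
  then show ?thesis by (simp flip: mult.assoc exp_add)
qed

section \<open>Dynamics of the observation error\<close>

lemma sampling_times_nonneg:
  assumes "sampling_times T ts"
  shows "0 \<le> ts j"
  using assms by (induction j) (auto simp: sampling_times_def intro: less_imp_le order_trans)

lemma finite_sampling_indices:
  assumes "sampling_times T ts"
  shows "finite {j. ts j \<le> x}"
proof -
  have "\<forall>\<^sub>F j in sequentially. x < ts j"
    using assms by (simp add: sampling_times_def filterlim_at_top_dense)
  then obtain m where "\<And>j. j \<ge> m \<Longrightarrow> x < ts j"
    by (auto simp: eventually_sequentially)
  then have "{j. ts j \<le> x} \<subseteq> {..<m}"
    by (auto simp: not_le[symmetric])
  then show ?thesis by (rule finite_subset) simp
qed

lemma sampling_interval:
  assumes "sampling_times T ts" "0 \<le> t"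
  obtains j where "ts j \<le> t" "t < ts (Suc j)"
proof -
  let ?J = "{j. ts j \<le> t}"
  have fin: "finite ?J" by (rule finite_sampling_indices[OF assms(1)])
  have "0 \<in> ?J" using assms by (simp add: sampling_times_def)
  then have "Max ?J \<in> ?J" using fin by (intro Max_in) auto
  moreover have "Suc (Max ?J) \<notin> ?J" using Max_ge[OF fin, of "Suc (Max ?J)"] by auto
  ultimately show ?thesis using that[of "Max ?J"] by auto
qed

lemma has_real_derivative_coef:
  assumes "(u has_vector_derivative u') (at t)"
  shows "((\<lambda>t. coef (u t) n) has_real_derivative coef u' n) (at t)"
  unfolding coef_def has_real_derivative_iff_has_vector_derivative
  using bounded_linear_inner_left assms by (rule bounded_linear.has_vector_derivative)

lemma coef_evolution:
  assumes "u \<in> state_space"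
  shows "coef (- (Dx ^^ 4) u - q *\<^sub>R (Dx ^^ 2) u + f) n = mu q n * coef u n + coef f n"
  by (simp add: coef_simps coef_Dx_state_space[OF assms] mu_def power2_eq_square algebra_simps)

lemma coef_low_mode_sum:
  "coef (\<Sum>i\<le>N. a i *\<^sub>R phi i) n = (if n \<le> N then a n else 0)"
  unfolding coef_def inner_sum_left by (simp add: inner_phi if_distrib sum.delta cong: if_cong)

lemma continuous_on_coef:
  "continuous_on S u \<Longrightarrow> continuous_on S (\<lambda>t. coef (u t) n)"
  unfolding coef_def by (intro continuous_intros)

lemma solution_continuous:
  assumes "plant_observer_solution q c N L r f xi ts u uh w"
  shows "continuous_on {0..} u" "continuous_on {0..} uh"
proof -
  obtain u' where "\<And>t. t \<in> {0..} \<Longrightarrow> (u has_vector_derivative u' t) (at t within {0..})"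
    using assms unfolding plant_observer_solution_def C1_on_def by blast
  then show "continuous_on {0..} u"
    unfolding continuous_on_eq_continuous_within
    by (intro ballI has_vector_derivative_continuous)
  show "continuous_on {0..} uh"
    using assms unfolding plant_observer_solution_def by (elim conjE)
qed

text \<open>
  The contributions of \<open>f\<close> to plant and observer cancel, and the injection reaches the modes up to \<open>N\<close>.
\<close>

lemma coef_error_deriv:
  assumes sol: "plant_observer_solution q c N L r f xi ts u uh w" and t: "0 < t" "t \<notin> range ts"
  shows "((\<lambda>t. coef (uh t - u t) n) has_real_derivative mu q n * coef (uh t - u t) n
    + (if n \<le> N then (inner (G_proj N c) (uh t) - w t) * vec_index L n else 0)) (at t)"
proof -
  have ss: "u t \<in> state_space" "uh t \<in> state_space"
    using sol t(1) unfolding plant_observer_solution_def by auto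
  have "(u has_vector_derivative (- (Dx ^^ 4) (u t) - q *\<^sub>R (Dx ^^ 2) (u t) + f t)) (at t)"
    using sol t(1) unfolding plant_observer_solution_def by blast
  from has_real_derivative_coef[OF this, of n]
  have "((\<lambda>t. coef (u t) n) has_real_derivative mu q n * coef (u t) n + coef (f t) n) (at t)"
    by (simp only: coef_evolution[OF ss(1)])
  moreover have "(uh has_vector_derivative
        (- (Dx ^^ 4) (uh t) - q *\<^sub>R (Dx ^^ 2) (uh t) + f t
          + (inner (G_proj N c) (uh t) - w t) *\<^sub>R (\<Sum>n\<le>N. vec_index L n *\<^sub>R phi n))) (at t)"
    using sol t unfolding plant_observer_solution_def by blast
  from has_real_derivative_coef[OF this, of n]
  have "((\<lambda>t. coef (uh t) n) has_real_derivative mu q n * coef (uh t) n + coef (f t) n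
      + (inner (G_proj N c) (uh t) - w t) * (if n \<le> N then vec_index L n else 0)) (at t)"
    by (simp only: coef_simps(1,3)[of "_ + _"] coef_simps(3) coef_simps(1)[of "- (Dx ^^ 4) (uh t) - q *\<^sub>R (Dx ^^ 2) (uh t) + f t"]
        coef_evolution[OF ss(2)] coef_low_mode_sum)
  ultimately show ?thesis
    unfolding coef_simps
    by (auto intro!: derivative_eq_intros simp: algebra_simps)
qed

lemma high_mode_error_decay:
  assumes sol: "plant_observer_solution q c N L r f xi ts u uh w" and ts: "sampling_times T ts"
    and "0 \<le> t" "N < n"
  shows "coef (uh t - u t) n = exp (mu q n * t) * coef (uh 0 - u 0) n"
proof (rule homogeneous_linear_ode[OF assms(3)])
  show "finite (ts ` {j. ts j \<le> t})" using finite_sampling_indices[OF ts] by simp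
  show "continuous_on {0..t} (\<lambda>t. coef (uh t - u t) n)"
    by (intro continuous_on_coef continuous_intros continuous_on_subset[OF solution_continuous(1)[OF sol]]
        continuous_on_subset[OF solution_continuous(2)[OF sol]]) auto
  show "((\<lambda>t. coef (uh t - u t) n) has_real_derivative mu q n * coef (uh s - u s) n) (at s)"
    if s: "s \<in> {0<..<t} - ts ` {j. ts j \<le> t}" for s
  proof -
    have "s \<notin> range ts"
    proof
      assume "s \<in> range ts"
      then obtain j where "s = ts j" by blast
      then show False using s by auto
    qed
    then show ?thesis using coef_error_deriv[OF sol, of s n] s assms(4) by simp
  qed
qed

text \<open>
  The predictor copies the dynamics of \<open>\<langle>Gc, u\<rangle>\<close> with \<open>uh\<close> in place of \<open>u\<close>, so its error is driven by
  \<open>uh - u\<close> alone. The sampling times themselves are excluded: there, the left end of the interval may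
  be time 0, at which the plant equation is not imposed.
\<close>

lemma predictor_error_deriv:
  assumes sol: "plant_observer_solution q c N L r f xi ts u uh w"
    and ts: "sampling_times T ts" and s: "s \<in> {ts j<..<ts (Suc j)}"
  shows "((\<lambda>t. w t - inner (G_proj N c) (u t)) has_real_derivative
    (\<Sum>n\<le>N. coef c n * (mu q n + r) * coef (uh s - u s) n)
      - r * (w s - inner (G_proj N c) (u s))) (at s)"
proof -
  have s0: "0 < s" using s sampling_times_nonneg[OF ts, of j] by auto
  have "u s \<in> state_space" using sol s0 unfolding plant_observer_solution_def by auto
  have "(u has_vector_derivative (- (Dx ^^ 4) (u s) - q *\<^sub>R (Dx ^^ 2) (u s) + f s)) (at s)"
    using sol s0 unfolding plant_observer_solution_def by blast
  from has_real_derivative_coef[OF this]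
  have "((\<lambda>t. coef (u t) n) has_real_derivative mu q n * coef (u s) n + coef (f s) n) (at s)" for n
    by (simp only: coef_evolution[OF \<open>u s \<in> state_space\<close>])
  then have Gu: "((\<lambda>t. inner (G_proj N c) (u t)) has_real_derivative
      (\<Sum>n\<le>N. coef c n * (mu q n * coef (u s) n + coef (f s) n))) (at s)"
    unfolding inner_G_proj by (intro DERIV_sum DERIV_cmult)
  have "(w has_real_derivative
        ((\<Sum>n\<le>N. mu q n * coef c n * inner (phi n) (uh s)) + inner (G_proj N c) (f s)
          - r * (w s - inner (G_proj N c) (uh s)))) (at s within {ts j..<ts (Suc j)})"
    using sol s unfolding plant_observer_solution_def by auto
  moreover have "at s within {ts j..<ts (Suc j)} = at s"
    by (rule at_within_open_subset[OF s]) auto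
  ultimately have "(w has_real_derivative
        ((\<Sum>n\<le>N. mu q n * coef c n * coef (uh s) n) + inner (G_proj N c) (f s)
          - r * (w s - inner (G_proj N c) (uh s)))) (at s)"
    by (simp add: coef_def inner_commute)
  from DERIV_diff[OF this Gu] show ?thesis
    by (rule DERIV_cong)
      (simp add: inner_G_proj coef_simps algebra_simps sum.distrib sum_subtractf sum_distrib_left)
qed

lemma predictor_error_continuous:
  assumes sol: "plant_observer_solution q c N L r f xi ts u uh w"
    and ts: "sampling_times T ts" and t: "t < ts (Suc j)"
  shows "continuous_on {ts j..t} (\<lambda>t. w t - inner (G_proj N c) (u t))"
proof (intro continuous_intros)
  have "\<forall>s\<in>{ts j..<ts (Suc j)}. (w has_real_derivative
        ((\<Sum>n\<le>N. mu q n * coef c n * inner (phi n) (uh s)) + inner (G_proj N c) (f s)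
          - r * (w s - inner (G_proj N c) (uh s)))) (at s within {ts j..<ts (Suc j)})"
    using sol unfolding plant_observer_solution_def by blast
  then have "continuous_on {ts j..<ts (Suc j)} w"
    by (intro DERIV_continuous_on) auto
  then show "continuous_on {ts j..t} w"
    by (rule continuous_on_subset) (use t in auto)
  show "continuous_on {ts j..t} u"
    using solution_continuous(1)[OF sol] by (rule continuous_on_subset)
      (use sampling_times_nonneg[OF ts, of j] in auto)
qed

text \<open>
  The reset formula is designed for this identity: the low modes of the error cancel and only the
  noise and the high modes remain.
\<close>

lemma predictor_error_at_sampling:
  assumes sol: "plant_observer_solution q c N L r f xi ts u uh w"
  shows "w (ts j) - inner (G_proj N c) (u (ts j))
    = xi (ts j) - inner c ((uh (ts j) - u (ts j)) - G_proj N (uh (ts j) - u (ts j)))"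
proof -
  have "w (ts j) = (inner c (u (ts j)) + xi (ts j)) + inner (G_proj N c - c) (uh (ts j))"
    using sol unfolding plant_observer_solution_def by (elim conjE) simp
  then show ?thesis
    by (simp add: inner_diff_left inner_diff_right inner_G_proj inner_G_proj_right coef_simps
        algebra_simps sum_subtractf)
qed

lemma closed_loop_matrix:
  assumes "L \<in> carrier_vec (N + 1)"
  shows "A_mat q N + col_mat L * C_mat c N \<in> carrier_mat (N + 1) (N + 1)"
    and "i < N + 1 \<Longrightarrow> j < N + 1 \<Longrightarrow> (A_mat q N + col_mat L * C_mat c N) $$ (i, j)
      = (if i = j then mu q i else 0) + vec_index L i * coef c j"
  using assms by (auto simp: A_mat_def col_mat_def C_mat_def mat_diag_def scalar_prod_def mat_of_cols_def)

lemma output_drift_matrix: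
  "C_mat c N * (A_mat q N + r \<cdot>\<^sub>m 1\<^sub>m (N + 1)) \<in> carrier_mat 1 (N + 1)"
  unfolding carrier_mat_def by (simp add: C_mat_def A_mat_def mat_diag_def)

lemma output_drift_bound:
  "\<bar>\<Sum>n\<le>N. coef c n * (mu q n + r) * x n\<bar>
    \<le> induced_norm (C_mat c N * (A_mat q N + r \<cdot>\<^sub>m 1\<^sub>m (N + 1))) * L2_set x {..N}"
proof -
  let ?K = "C_mat c N * (A_mat q N + r \<cdot>\<^sub>m 1\<^sub>m (N + 1))"
  have entry: "?K $$ (0, n) = coef c n * (mu q n + r)" if "n < N + 1" for n
  proof -
    have "?K $$ (0, n) = (\<Sum>i<N + 1. coef c i * ((if i = n then mu q n else 0) + r * (if i = n then 1 else 0)))"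
      using that by (auto simp: C_mat_def A_mat_def mat_diag_def scalar_prod_def atLeast0LessThan
          intro!: sum.cong)
    also have "\<dots> = (\<Sum>i<N + 1. if i = n then coef c n * (mu q n + r) else 0)"
      by (intro sum.cong) auto
    finally show ?thesis using that by simp
  qed
  have idx: "{..<N + 1} = {..N}" by auto
  have "\<bar>\<Sum>n\<le>N. coef c n * (mu q n + r) * x n\<bar> = L2_set (\<lambda>i. \<Sum>n<N + 1. ?K $$ (i, n) * x n) {..<1}"
  proof -
    have "(\<Sum>n<N + 1. ?K $$ (0, n) * x n) = (\<Sum>n<N + 1. coef c n * (mu q n + r) * x n)"
      by (intro sum.cong refl) (simp only: entry lessThan_iff)
    moreover have "{..<1} = {0::nat}" by auto
    ultimately show ?thesis unfolding idx[symmetric] by (simp only: L2_set_def) simp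
  qed
  also have "\<dots> \<le> induced_norm ?K * L2_set x {..<N + 1}"
    by (rule induced_norm_bound[OF output_drift_matrix])
  finally show ?thesis unfolding idx .
qed

section \<open>The small-gain estimate\<close>

text \<open>
  The loop gain \<open>\<theta>\<close> has two parts: \<open>\<kappa> * J\<close> bounds the drift of \<open>d\<close> over one sampling interval in terms of
  \<open>z\<close>, and \<open>H\<close> collects the gain \<open>R |L| / (\<omega> - \<sigma>)\<close> from \<open>d\<close> to \<open>z\<close>, the factor \<open>\<rho>\<close> from
  \<open>predictor_bound\<close> and \<open>exp (\<sigma> * T)\<close>, the price for comparing the weight at a time with the weight at
  the preceding sample, which is at most \<open>T\<close> earlier.
\<close>

lemma sampled_error_estimates:
  fixes q r R \<omega> \<sigma> T t \<Xi> :: real and c :: L2 and N :: nat and L :: "real Matrix.vec"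
  defines "\<rho> \<equiv> exp (max 0 (- r) * T)" and "J \<equiv> integral {0..T} (\<lambda>s. exp (r * s))"
    and "\<kappa> \<equiv> induced_norm (C_mat c N * (A_mat q N + r \<cdot>\<^sub>m 1\<^sub>m (N + 1)))"
  defines "H \<equiv> R * vec_norm L * \<rho> * exp (\<sigma> * T) / (\<omega> - \<sigma>)"
  defines "\<theta> \<equiv> H * \<kappa> * J"
  assumes q: "(real N + 1)\<^sup>2 * pi\<^sup>2 > q" and L: "L \<in> carrier_vec (N + 1)"
    and R: "R > 0" and norm_exp: "\<And>t. t \<ge> 0 \<Longrightarrow>
      induced_norm (mat_exp (t \<cdot>\<^sub>m (A_mat q N + col_mat L * C_mat c N))) \<le> R * exp (- \<omega> * t)"
    and \<sigma>: "0 < \<sigma>" "\<sigma> < \<omega>" "\<sigma> \<le> - mu q (N + 1)" and \<theta>: "\<theta> < 1" and T: "T > 0"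
    and sol: "plant_observer_solution q c N L r f xi ts u uh w" and ts: "sampling_times T ts"
    and t: "0 \<le> t" and xi: "\<And>s. s \<in> {0..t} \<Longrightarrow> \<bar>xi s\<bar> \<le> \<Xi>"
  shows "\<And>n. N < n \<Longrightarrow> \<bar>coef (uh t - u t) n\<bar> \<le> exp (- \<sigma> * t) * \<bar>coef (uh 0 - u 0) n\<bar>"
    and "L2_set (coef (uh t - u t)) {..N}
      \<le> (R + H * norm c) / (1 - \<theta>) * exp (- \<sigma> * t) * norm (uh 0 - u 0) + H / (1 - \<theta>) * \<Xi>"
proof -
  define e where "e s = uh s - u s" for s
  define d where "d s = w s - inner (G_proj N c) (u s)" for s
  define p where "p s = L2_set (coef (e s)) {..N}" for s
  have idx: "{..<N + 1} = {..N}" by auto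
  have mu_le: "mu q n \<le> - \<sigma>" if "N < n" for n
  proof -
    have lam: "lam (N + 1) \<le> lam n"
      using that by (auto simp: lam_def intro!: mult_right_mono power_mono)
    have pos: "0 \<le> lam (N + 1)" "0 \<le> lam (N + 1) - q"
      using q by (auto simp: lam_def add.commute)
    have "lam (N + 1) * (lam (N + 1) - q) \<le> lam n * (lam n - q)"
      using lam pos by (intro mult_mono) auto
    then show ?thesis using \<sigma>(3) by (simp add: mu_def)
  qed
  have high: "\<bar>coef (uh s - u s) n\<bar> \<le> exp (- \<sigma> * s) * \<bar>coef (uh 0 - u 0) n\<bar>"
    if "N < n" "0 \<le> s" for n s
    unfolding high_mode_error_decay[OF sol ts that(2,1)] abs_mult
    using mult_right_mono[OF mu_le[OF that(1)] that(2)] by (simp add: mult_right_mono)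
  show "\<bar>coef (uh t - u t) n\<bar> \<le> exp (- \<sigma> * t) * \<bar>coef (uh 0 - u 0) n\<bar>" if "N < n" for n
    by (rule high[OF that t])
  have tail: "norm (e s - G_proj N (e s)) \<le> exp (- \<sigma> * s) * norm (e 0)" if "0 \<le> s" for s
    using high that unfolding e_def by (intro norm_tail_le) auto
  have \<Xi>: "0 \<le> \<Xi>" using xi[of 0] t by force
  have nonneg: "0 \<le> vec_norm L" "0 \<le> \<rho>" "1 \<le> exp (\<sigma> * T)" "0 \<le> J" "0 \<le> \<kappa>"
  proof -
    show "0 \<le> vec_norm L" by (simp add: vec_norm_def)
    show "0 \<le> J" unfolding J_def
      by (rule Henstock_Kurzweil_Integration.integral_nonneg)
        (auto intro!: integrable_continuous_real continuous_intros)
    show "0 \<le> \<kappa>" unfolding \<kappa>_def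
      by (rule induced_norm_nonneg[OF output_drift_matrix]) simp
  qed (use \<sigma> T in \<open>auto simp: \<rho>_def\<close>)
  \<comment> \<open>\<open>\<beta>\<close> bounds the weighted reset values; \<open>exp (\<sigma> * t)\<close> is the largest weight that meets the noise, and it cancels at time \<open>t\<close>.\<close>
  define \<beta> where "\<beta> = norm c * norm (e 0) + \<Xi> * exp (\<sigma> * t)"
  have \<beta>0: "0 \<le> \<beta>" using \<Xi> by (simp add: \<beta>_def)
  have e_cont: "continuous_on {0..} e"
    unfolding e_def by (intro continuous_intros solution_continuous[OF sol])
  have p_cont: "continuous_on {0..t} p"
  proof -
    have "continuous_on {0..} p"
      unfolding p_def L2_set_def by (intro continuous_intros continuous_on_coef e_cont)
    then show ?thesis by (rule continuous_on_subset) auto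
  qed
  have d_bound: "\<bar>d \<tau>\<bar> \<le> \<rho> * exp (\<sigma> * T) * (\<beta> + \<kappa> * J * P) * exp (- \<sigma> * \<tau>)"
    if \<tau>: "\<tau> \<in> {0..t}" and P: "0 \<le> P" and p_le: "\<And>s. s \<in> {0..\<tau>} \<Longrightarrow> p s \<le> P * exp (- \<sigma> * s)" for \<tau> P
  proof -
    obtain j where j: "ts j \<le> \<tau>" "\<tau> < ts (Suc j)"
      using sampling_interval[OF ts, of \<tau>] \<tau> by auto
    define a where "a = ts j"
    have a: "0 \<le> a" "a \<le> \<tau>" "\<tau> \<le> a + T"
    proof -
      show "0 \<le> a" unfolding a_def by (rule sampling_times_nonneg[OF ts])
      have "ts (Suc j) \<le> ts j + T" using ts by (simp add: sampling_times_def)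
      then show "\<tau> \<le> a + T" using j by (simp add: a_def)
    qed (use j in \<open>simp add: a_def\<close>)
    have "\<bar>d \<tau>\<bar> \<le> \<rho> * (\<bar>d a\<bar> + \<kappa> * P * exp (- \<sigma> * a) * J)"
      unfolding \<rho>_def J_def
    proof (rule predictor_bound[OF a(2,3)])
      show "continuous_on {a..\<tau>} d"
        unfolding a_def d_def by (rule predictor_error_continuous[OF sol ts j(2)])
      show "(d has_real_derivative (\<Sum>n\<le>N. coef c n * (mu q n + r) * coef (e s) n) - r * d s) (at s)"
        if "s \<in> {a<..<\<tau>}" for s
        unfolding d_def e_def using that j
        by (intro predictor_error_deriv[OF sol ts, of _ j]) (auto simp: a_def)
      show "\<bar>\<Sum>n\<le>N. coef c n * (mu q n + r) * coef (e s) n\<bar> \<le> \<kappa> * P * exp (- \<sigma> * a)"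
        if s: "s \<in> {a..\<tau>}" for s
      proof -
        have "\<bar>\<Sum>n\<le>N. coef c n * (mu q n + r) * coef (e s) n\<bar> \<le> \<kappa> * p s"
          unfolding \<kappa>_def p_def by (rule output_drift_bound)
        also have "\<dots> \<le> \<kappa> * (P * exp (- \<sigma> * s))"
          using s a nonneg by (intro mult_left_mono p_le) auto
        also have "\<dots> \<le> \<kappa> * (P * exp (- \<sigma> * a))"
          using s \<sigma> P nonneg by (intro mult_left_mono) auto
        finally show ?thesis by simp
      qed
    qed
    also have "\<dots> \<le> \<rho> * ((\<beta> + \<kappa> * J * P) * (exp (\<sigma> * T) * exp (- \<sigma> * \<tau>)))"
    proof (rule mult_left_mono)
      have exp_a: "exp (- \<sigma> * a) \<le> exp (\<sigma> * T) * exp (- \<sigma> * \<tau>)"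
        using mult_left_mono[OF a(3), of \<sigma>] \<sigma>(1) by (simp add: algebra_simps flip: exp_add)
      have "\<bar>inner c (e a - G_proj N (e a))\<bar> \<le> norm c * norm (e a - G_proj N (e a))"
        by (rule Cauchy_Schwarz_ineq2)
      also have "\<dots> \<le> norm c * (exp (- \<sigma> * a) * norm (e 0))"
        by (intro mult_left_mono tail a(1)) simp
      also have "\<dots> = norm c * norm (e 0) * exp (- \<sigma> * a)" by simp
      also have "\<dots> \<le> norm c * norm (e 0) * (exp (\<sigma> * T) * exp (- \<sigma> * \<tau>))"
        by (intro mult_left_mono exp_a) auto
      finally have 1: "\<bar>inner c (e a - G_proj N (e a))\<bar>
          \<le> norm c * norm (e 0) * (exp (\<sigma> * T) * exp (- \<sigma> * \<tau>))" .
      have "\<bar>xi a\<bar> \<le> \<Xi>" using a \<tau> by (intro xi) auto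
      also have "\<Xi> \<le> \<Xi> * exp (\<sigma> * t) * (exp (\<sigma> * T) * exp (- \<sigma> * \<tau>))"
      proof -
        have "\<sigma> * \<tau> \<le> \<sigma> * (t + T)"
          using \<tau> \<sigma>(1) T by (intro mult_left_mono) auto
        then have "0 \<le> \<sigma> * t + \<sigma> * T - \<sigma> * \<tau>" by (simp add: distrib_left)
        then have "1 \<le> exp (\<sigma> * t) * (exp (\<sigma> * T) * exp (- \<sigma> * \<tau>))"
          by (simp flip: exp_add)
        from mult_left_mono[OF this \<Xi>] show ?thesis by (simp add: mult.assoc)
      qed
      finally have 2: "\<bar>xi a\<bar> \<le> \<Xi> * exp (\<sigma> * t) * (exp (\<sigma> * T) * exp (- \<sigma> * \<tau>))" .
      have "\<bar>d a\<bar> \<le> \<bar>xi a\<bar> + \<bar>inner c (e a - G_proj N (e a))\<bar>"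
        unfolding d_def e_def a_def predictor_error_at_sampling[OF sol] by (rule abs_triangle_ineq4)
      with 1 2 have d_a: "\<bar>d a\<bar> \<le> \<beta> * (exp (\<sigma> * T) * exp (- \<sigma> * \<tau>))"
        unfolding \<beta>_def distrib_right by linarith
      have "\<kappa> * P * exp (- \<sigma> * a) * J = \<kappa> * J * P * exp (- \<sigma> * a)" by simp
      also have "\<dots> \<le> \<kappa> * J * P * (exp (\<sigma> * T) * exp (- \<sigma> * \<tau>))"
        using nonneg P by (intro mult_left_mono exp_a) auto
      finally show "\<bar>d a\<bar> + \<kappa> * P * exp (- \<sigma> * a) * J
          \<le> (\<beta> + \<kappa> * J * P) * (exp (\<sigma> * T) * exp (- \<sigma> * \<tau>))"
        using d_a unfolding distrib_right by linarith
    qed (rule nonneg)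
    finally show ?thesis by (simp add: mult_ac)
  qed
  have "p t \<le> exp (- \<sigma> * t) * ((R * p 0 + H * \<beta>) / (1 - \<theta>))"
  proof (rule weighted_small_gain[OF t p_cont _ \<theta>])
    show "0 \<le> p s" for s by (simp add: p_def)
    fix P s assume P: "0 \<le> P" and s: "s \<in> {0..t}"
      and p_le: "\<And>\<tau>. \<tau> \<in> {0..s} \<Longrightarrow> p \<tau> \<le> P * exp (- \<sigma> * \<tau>)"
    define G where "G = vec_norm L * (\<rho> * exp (\<sigma> * T) * (\<beta> + \<kappa> * J * P))"
    have "L2_set (coef (e s)) {..<N + 1} \<le> exp (- \<sigma> * s)
        * (R * L2_set (coef (e 0)) {..<N + 1} + R * G / (\<omega> - \<sigma>))"
    proof (rule exp_forcing_bound[OF closed_loop_matrix(1)[OF L] norm_exp _ \<sigma>(2),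
          where S = "ts ` {j. ts j \<le> s}" and g = "\<lambda>t i. - d t * vec_index L i"])
      show "finite (ts ` {j. ts j \<le> s})" using finite_sampling_indices[OF ts] by simp
      show "continuous_on {0..s} (\<lambda>t. coef (e t) i)" for i
        by (intro continuous_on_coef continuous_on_subset[OF e_cont]) auto
      show "0 \<le> G" unfolding G_def using nonneg \<beta>0 P by simp
      show "L2_set (\<lambda>i. - d \<tau> * vec_index L i) {..<N + 1} \<le> G * exp (- \<sigma> * \<tau>)"
        if \<tau>: "\<tau> \<in> {0..s}" for \<tau>
      proof -
        have "L2_set (\<lambda>i. - d \<tau> * vec_index L i) {..<N + 1}
            = L2_set (\<lambda>i. \<bar>d \<tau>\<bar> * vec_index L i) {..<N + 1}"
          by (simp add: L2_set_def power_mult_distrib)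
        also have "\<dots> = vec_norm L * \<bar>d \<tau>\<bar>"
          using L unfolding vec_norm_def by (simp add: L2_set_right_distrib[symmetric] mult.commute)
        also have "\<dots> \<le> vec_norm L * (\<rho> * exp (\<sigma> * T) * (\<beta> + \<kappa> * J * P) * exp (- \<sigma> * \<tau>))"
          using \<tau> s by (intro mult_left_mono d_bound P p_le nonneg) auto
        finally show ?thesis by (simp add: G_def mult_ac)
      qed
      fix i \<tau> assume i: "i < N + 1" and \<tau>: "\<tau> \<in> {0<..<s} - ts ` {j. ts j \<le> s}"
      have "\<tau> \<notin> range ts"
      proof
        assume "\<tau> \<in> range ts"
        then obtain j where "\<tau> = ts j" by blast
        then show False using \<tau> by auto
      qed
      then have "((\<lambda>t. coef (e t) i) has_real_derivative mu q i * coef (e \<tau>) i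
          + (inner (G_proj N c) (uh \<tau>) - w \<tau>) * vec_index L i) (at \<tau>)"
        unfolding e_def using coef_error_deriv[OF sol, of \<tau> i] \<tau> i by auto
      moreover have "inner (G_proj N c) (uh \<tau>) - w \<tau> = (\<Sum>j\<le>N. coef c j * coef (e \<tau>) j) - d \<tau>"
        unfolding d_def e_def by (simp add: inner_G_proj coef_simps algebra_simps sum_subtractf)
      moreover have "(\<Sum>j<N + 1. (A_mat q N + col_mat L * C_mat c N) $$ (i, j) * coef (e \<tau>) j)
          = mu q i * coef (e \<tau>) i + vec_index L i * (\<Sum>j\<le>N. coef c j * coef (e \<tau>) j)"
      proof -
        have "(\<Sum>j<N + 1. (A_mat q N + col_mat L * C_mat c N) $$ (i, j) * coef (e \<tau>) j)
            = (\<Sum>j<N + 1. (if i = j then mu q i * coef (e \<tau>) i else 0)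
                + vec_index L i * (coef c j * coef (e \<tau>) j))"
          using i by (intro sum.cong refl) (simp add: closed_loop_matrix(2)[OF L] algebra_simps del: index_add_mat)
        also have "\<dots> = mu q i * coef (e \<tau>) i + vec_index L i * (\<Sum>j<N + 1. coef c j * coef (e \<tau>) j)"
          using i unfolding sum.distrib sum_distrib_left by (simp add: sum.delta)
        finally show ?thesis unfolding idx .
      qed
      ultimately show "((\<lambda>t. coef (e t) i) has_real_derivative
          (\<Sum>j<N + 1. (A_mat q N + col_mat L * C_mat c N) $$ (i, j) * coef (e \<tau>) j)
            + - d \<tau> * vec_index L i) (at \<tau>)"
        by (simp add: algebra_simps)
    qed (use R s in auto)
    then have "p s \<le> exp (- \<sigma> * s) * (R * p 0 + R * G / (\<omega> - \<sigma>))"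
      unfolding p_def idx .
    also have "R * G / (\<omega> - \<sigma>) = H * (\<beta> + \<kappa> * J * P)"
      by (simp add: G_def H_def mult_ac)
    also have "\<dots> = H * \<beta> + \<theta> * P" by (simp add: \<theta>_def algebra_simps)
    finally show "p s \<le> exp (- \<sigma> * s) * (R * p 0 + H * \<beta> + \<theta> * P)"
      by (simp add: add.assoc)
  qed
  also have "\<dots> \<le> exp (- \<sigma> * t) * ((R * norm (e 0) + H * \<beta>) / (1 - \<theta>))"
  proof -
    have "p 0 \<le> norm (e 0)" using norm_G_proj_le[of N "e 0"] by (simp add: p_def norm_G_proj)
    then show ?thesis using R \<theta> by (intro mult_left_mono divide_right_mono add_right_mono) auto
  qed
  also have "\<dots> = (R + H * norm c) / (1 - \<theta>) * exp (- \<sigma> * t) * norm (e 0)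
      + H / (1 - \<theta>) * (\<Xi> * (exp (\<sigma> * t) * exp (- \<sigma> * t)))"
    by (simp add: \<beta>_def add_divide_distrib distrib_left distrib_right mult_ac)
  also have "exp (\<sigma> * t) * exp (- \<sigma> * t) = 1" by (simp flip: exp_add)
  finally show "L2_set (coef (uh t - u t)) {..N}
      \<le> (R + H * norm c) / (1 - \<theta>) * exp (- \<sigma> * t) * norm (uh 0 - u 0) + H / (1 - \<theta>) * \<Xi>"
    by (simp add: p_def e_def)
qed

text \<open>
  Transfers the estimates of the modes to any quantity that arises from the error by a diagonal
  operator; it is applied to the error and to its second and fourth derivatives.
\<close>

lemma norm_le_of_multiplier:
  assumes low: "L2_set (coef e) {..N} \<le> K * x * norm e0 + g * \<Xi>"
    and high: "\<And>n. N < n \<Longrightarrow> \<bar>coef e n\<bar> \<le> x * \<bar>coef e0 n\<bar>"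
    and mult: "\<And>n. coef v n = a n * coef e n" "\<And>n. coef v0 n = a n * coef e0 n"
    and a: "\<And>n. n \<le> N \<Longrightarrow> \<bar>a n\<bar> \<le> A"
    and "0 \<le> x" "g \<le> \<gamma>" "0 \<le> \<Xi>"
  shows "norm v \<le> A * x * K * norm e0 + x * norm v0 + \<gamma> * A * \<Xi>"
proof -
  have A: "0 \<le> A" using a[of 0] by force
  have "norm v \<le> L2_set (coef v) {..N} + x * norm v0"
  proof (rule norm_le_low_plus_tail)
    fix n assume "N < n"
    have "\<bar>coef v n\<bar> = \<bar>a n\<bar> * \<bar>coef e n\<bar>" by (simp add: mult abs_mult)
    also have "\<dots> \<le> \<bar>a n\<bar> * (x * \<bar>coef e0 n\<bar>)" by (intro mult_left_mono high \<open>N < n\<close>) simp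
    finally show "\<bar>coef v n\<bar> \<le> x * \<bar>coef v0 n\<bar>" by (simp add: mult abs_mult mult_ac)
  qed (rule assms)
  moreover have "L2_set (coef v) {..N} \<le> A * L2_set (coef e) {..N}"
  proof -
    have "L2_set (coef v) {..N} = L2_set (\<lambda>n. \<bar>coef v n\<bar>) {..N}" by (simp add: L2_set_def)
    also have "\<dots> \<le> L2_set (\<lambda>n. A * \<bar>coef e n\<bar>) {..N}"
      by (rule L2_set_mono) (auto simp: mult abs_mult intro!: mult_right_mono a)
    also have "\<dots> = A * L2_set (\<lambda>n. \<bar>coef e n\<bar>) {..N}"
      by (rule L2_set_right_distrib[OF A, symmetric])
    finally show ?thesis by (simp add: L2_set_def)
  qed
  moreover have "A * L2_set (coef e) {..N} \<le> A * (K * x * norm e0 + g * \<Xi>)"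
    by (intro mult_left_mono low A)
  moreover have "A * (g * \<Xi>) \<le> A * (\<gamma> * \<Xi>)"
    using assms A by (intro mult_left_mono mult_right_mono) auto
  ultimately show ?thesis by (simp add: algebra_simps)
qed

text \<open>
  At \<open>\<sigma> = 0\<close> the gain is \<open>Y / \<omega> < 1\<close>, and it depends continuously on \<open>\<sigma>\<close>.
\<close>

lemma admissible_decay_rate:
  fixes Y T \<omega> \<sigma>0 :: real
  assumes "Y < \<omega>" "0 < \<omega>" "0 < \<sigma>0"
  obtains \<sigma> where "0 < \<sigma>" "\<sigma> < \<omega>" "\<sigma> \<le> \<sigma>0" "Y * exp (\<sigma> * T) / (\<omega> - \<sigma>) < 1"
proof -
  have "((\<lambda>\<sigma>. Y * exp (\<sigma> * T) / (\<omega> - \<sigma>)) \<longlongrightarrow> Y * exp (0 * T) / (\<omega> - 0)) (at_right 0)"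
    using assms(2) by (intro tendsto_intros) auto
  moreover have "Y * exp (0 * T) / (\<omega> - 0) < 1" using assms by simp
  ultimately have "\<forall>\<^sub>F \<sigma> in at_right 0. Y * exp (\<sigma> * T) / (\<omega> - \<sigma>) < 1"
    by (rule order_tendstoD(2))
  moreover have "\<forall>\<^sub>F \<sigma> in at_right 0. \<sigma> \<in> {0<..<min \<omega> \<sigma>0}"
    using assms by (intro eventually_at_right_real) auto
  ultimately have "\<forall>\<^sub>F \<sigma> in at_right 0. 0 < \<sigma> \<and> \<sigma> < \<omega> \<and> \<sigma> \<le> \<sigma>0 \<and> Y * exp (\<sigma> * T) / (\<omega> - \<sigma>) < 1"
    by eventually_elim auto
  then show ?thesis using that eventually_happens'[OF trivial_limit_at_right_real] by blast
qed

theorem theorem1: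
  fixes q r R \<omega> Z :: real and c :: L2 and N :: nat and L :: "real Matrix.vec"
  assumes "N > 0"
    and "(real N + 1)\<^sup>2 * pi\<^sup>2 > q"
    and "\<And>n m. n \<le> N \<Longrightarrow> m \<le> N \<Longrightarrow> n \<noteq> m \<Longrightarrow> q \<noteq> ((real n)\<^sup>2 + (real m)\<^sup>2) * pi\<^sup>2"
    and "\<And>n. n \<le> N \<Longrightarrow> coef c n \<noteq> 0"
    and "L \<in> carrier_vec (N + 1)"
    and "R > 0" and "\<omega> > 0"
    and "\<And>t. t \<ge> 0 \<Longrightarrow>
      induced_norm (mat_exp (t \<cdot>\<^sub>m (A_mat q N + col_mat L * C_mat c N))) \<le> R * exp (- \<omega> * t)"
    and "Z = R * vec_norm L * induced_norm (C_mat c N * (A_mat q N + r \<cdot>\<^sub>m 1\<^sub>m (N + 1)))"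
  shows "\<forall>T>0. Z * exp (max 0 (- r) * T) * integral {0..T} (\<lambda>s. exp (r * s)) < \<omega> \<longrightarrow>
    (\<exists>\<sigma> \<gamma> M. \<sigma> > 0 \<and> \<gamma> > 0 \<and> M \<ge> 1 \<and>
      (\<forall>u0\<in>state_space. \<forall>uh0\<in>state_space. \<forall>f xi ts u uh w.
        C1_on {0..} f \<longrightarrow> essentially_bounded xi \<longrightarrow> sampling_times T ts \<longrightarrow>
        plant_observer_solution q c N L r f xi ts u uh w \<longrightarrow> u 0 = u0 \<longrightarrow> uh 0 = uh0 \<longrightarrow>
        (\<forall>t\<ge>0.
          ereal (norm (uh t - u t))
            \<le> ereal (M * exp (- \<sigma> * t) * norm (uh0 - u0))
              + ereal \<gamma> * (SUP s\<in>{0..t}. ereal \<bar>xi s\<bar>) \<and>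
          ereal (norm ((Dx ^^ 2) (uh t) - (Dx ^^ 2) (u t)))
            \<le> ereal ((real N)\<^sup>2 * pi\<^sup>2 * exp (- \<sigma> * t) * (M - 1) * norm (uh0 - u0)
                + exp (- \<sigma> * t) * norm ((Dx ^^ 2) uh0 - (Dx ^^ 2) u0))
              + ereal (\<gamma> * (real N)\<^sup>2 * pi\<^sup>2) * (SUP s\<in>{0..t}. ereal \<bar>xi s\<bar>) \<and>
          ereal (norm ((Dx ^^ 4) (uh t) - (Dx ^^ 4) (u t)))
            \<le> ereal ((real N) ^ 4 * pi ^ 4 * exp (- \<sigma> * t) * (M - 1) * norm (uh0 - u0)
                + exp (- \<sigma> * t) * norm ((Dx ^^ 4) uh0 - (Dx ^^ 4) u0))
              + ereal (\<gamma> * (real N) ^ 4 * pi ^ 4) * (SUP s\<in>{0..t}. ereal \<bar>xi s\<bar>))))"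
proof (intro allI impI)
  fix T :: real assume T: "T > 0"
    and gain: "Z * exp (max 0 (- r) * T) * integral {0..T} (\<lambda>s. exp (r * s)) < \<omega>"
  define \<rho> J \<kappa> where "\<rho> = exp (max 0 (- r) * T)" and "J = integral {0..T} (\<lambda>s. exp (r * s))"
    and "\<kappa> = induced_norm (C_mat c N * (A_mat q N + r \<cdot>\<^sub>m 1\<^sub>m (N + 1)))"
  have "0 < - mu q (N + 1)"
    using assms(2) by (auto simp: mu_def lam_def add.commute intro!: mult_pos_pos)
  then obtain \<sigma> where \<sigma>: "0 < \<sigma>" "\<sigma> < \<omega>" "\<sigma> \<le> - mu q (N + 1)"
    and \<sigma>_gain: "Z * \<rho> * J * exp (\<sigma> * T) / (\<omega> - \<sigma>) < 1"
    using admissible_decay_rate[of "Z * \<rho> * J" \<omega> "- mu q (N + 1)" T] gain assms(7)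
    unfolding \<rho>_def J_def by blast
  define H where "H = R * vec_norm L * \<rho> * exp (\<sigma> * T) / (\<omega> - \<sigma>)"
  define \<theta> where "\<theta> = H * \<kappa> * J"
  have \<theta>: "\<theta> < 1"
    using \<sigma>_gain by (simp add: \<theta>_def H_def assms(9) \<kappa>_def mult_ac)
  have H0: "0 \<le> H"
    using assms(6) \<sigma> by (simp add: H_def \<rho>_def vec_norm_def)
  \<comment> \<open>\<open>K\<close> is the gain from the initial error to the low modes; \<open>M = K + 1\<close> also accounts for the tail.\<close>
  define K where "K = (R + H * norm c) / (1 - \<theta>)"
  \<comment> \<open>The summand 1 keeps the noise gain positive when \<open>L = 0\<close>.\<close>
  define \<gamma> where "\<gamma> = H / (1 - \<theta>) + 1"
  have K0: "0 \<le> K" using H0 \<theta> assms(6) by (simp add: K_def)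
  have \<gamma>0: "0 < \<gamma>" using H0 \<theta> by (simp add: \<gamma>_def add_nonneg_pos)
  show "\<exists>\<sigma> \<gamma> M. \<sigma> > 0 \<and> \<gamma> > 0 \<and> M \<ge> 1 \<and>
      (\<forall>u0\<in>state_space. \<forall>uh0\<in>state_space. \<forall>f xi ts u uh w.
        C1_on {0..} f \<longrightarrow> essentially_bounded xi \<longrightarrow> sampling_times T ts \<longrightarrow>
        plant_observer_solution q c N L r f xi ts u uh w \<longrightarrow> u 0 = u0 \<longrightarrow> uh 0 = uh0 \<longrightarrow>
        (\<forall>t\<ge>0.
          ereal (norm (uh t - u t))
            \<le> ereal (M * exp (- \<sigma> * t) * norm (uh0 - u0))
              + ereal \<gamma> * (SUP s\<in>{0..t}. ereal \<bar>xi s\<bar>) \<and>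
          ereal (norm ((Dx ^^ 2) (uh t) - (Dx ^^ 2) (u t)))
            \<le> ereal ((real N)\<^sup>2 * pi\<^sup>2 * exp (- \<sigma> * t) * (M - 1) * norm (uh0 - u0)
                + exp (- \<sigma> * t) * norm ((Dx ^^ 2) uh0 - (Dx ^^ 2) u0))
              + ereal (\<gamma> * (real N)\<^sup>2 * pi\<^sup>2) * (SUP s\<in>{0..t}. ereal \<bar>xi s\<bar>) \<and>
          ereal (norm ((Dx ^^ 4) (uh t) - (Dx ^^ 4) (u t)))
            \<le> ereal ((real N) ^ 4 * pi ^ 4 * exp (- \<sigma> * t) * (M - 1) * norm (uh0 - u0)
                + exp (- \<sigma> * t) * norm ((Dx ^^ 4) uh0 - (Dx ^^ 4) u0))
              + ereal (\<gamma> * (real N) ^ 4 * pi ^ 4) * (SUP s\<in>{0..t}. ereal \<bar>xi s\<bar>)))"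
  proof (rule exI[of _ \<sigma>], rule exI[of _ \<gamma>], rule exI[of _ "K + 1"], intro conjI ballI allI impI)
    show "0 < \<sigma>" "0 < \<gamma>" "1 \<le> K + 1" using \<sigma>(1) \<gamma>0 K0 by auto
    fix u0 uh0 f xi ts u uh w t
    assume ss: "u0 \<in> state_space" "uh0 \<in> state_space" and ts: "sampling_times T ts"
      and sol: "plant_observer_solution q c N L r f xi ts u uh w"
      and init: "u 0 = u0" "uh 0 = uh0" and t: "0 \<le> (t::real)"
    define S where "S = (SUP s\<in>{0..t}. ereal \<bar>xi s\<bar>)"
    have S_upper: "ereal \<bar>xi s\<bar> \<le> S" if "s \<in> {0..t}" for s
      unfolding S_def using that by (rule SUP_upper)
    have S0: "0 \<le> S" using S_upper[of 0] t order_trans[of 0 "ereal \<bar>xi 0\<bar>" S] by simp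
    have sst: "u t \<in> state_space" "uh t \<in> state_space"
      using sol t unfolding plant_observer_solution_def by auto
    (* An infinite supremum makes each estimate trivial, because its gain is positive. *)
    have reduce: "ereal y \<le> ereal b + ereal k * S"
      if "0 < k" and fin: "\<And>\<Xi>. S = ereal \<Xi> \<Longrightarrow> y \<le> b + k * \<Xi>" for y b k
    proof (cases S)
      case (real \<Xi>)
      then show ?thesis using fin[OF real] by simp
    qed (use S0 that(1) in auto)
    have bound: "norm v \<le> A * exp (- \<sigma> * t) * K * norm (uh0 - u0) + exp (- \<sigma> * t) * norm v0 + \<gamma> * A * \<Xi>"
      if S: "S = ereal \<Xi>" and v: "\<And>n. coef v n = a n * coef (uh t - u t) n"
        "\<And>n. coef v0 n = a n * coef (uh0 - u0) n" and a: "\<And>n. n \<le> N \<Longrightarrow> \<bar>a n\<bar> \<le> A"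
      for v v0 a A \<Xi>
    proof -
      have xi: "\<bar>xi s\<bar> \<le> \<Xi>" if "s \<in> {0..t}" for s
        using S_upper[OF that] S by simp
      note est = sampled_error_estimates[OF assms(2,5,6,8) \<sigma> _ T sol ts t xi,
          folded \<rho>_def J_def \<kappa>_def, folded H_def, folded \<theta>_def, OF _ \<theta>, folded K_def, unfolded init]
      show ?thesis
        by (rule norm_le_of_multiplier[OF est(2) est(1) v a])
          (use S S0 in \<open>auto simp: \<gamma>_def\<close>)
    qed
    have lam_le: "lam n \<le> (real N)\<^sup>2 * pi\<^sup>2" "0 \<le> lam n" if "n \<le> N" for n
      using that by (auto simp: lam_def intro!: mult_right_mono power_mono)
    show "ereal (norm (uh t - u t)) \<le> ereal ((K + 1) * exp (- \<sigma> * t) * norm (uh0 - u0))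
        + ereal \<gamma> * (SUP s\<in>{0..t}. ereal \<bar>xi s\<bar>)"
      unfolding S_def[symmetric]
    proof (rule reduce[OF \<gamma>0])
      fix \<Xi> assume "S = ereal \<Xi>"
      from bound[OF this, of "uh t - u t" "\<lambda>_. 1" "uh0 - u0" 1]
      show "norm (uh t - u t) \<le> (K + 1) * exp (- \<sigma> * t) * norm (uh0 - u0) + \<gamma> * \<Xi>"
        by (simp add: algebra_simps)
    qed
    show "ereal (norm ((Dx ^^ 2) (uh t) - (Dx ^^ 2) (u t)))
        \<le> ereal ((real N)\<^sup>2 * pi\<^sup>2 * exp (- \<sigma> * t) * (K + 1 - 1) * norm (uh0 - u0)
            + exp (- \<sigma> * t) * norm ((Dx ^^ 2) uh0 - (Dx ^^ 2) u0))
          + ereal (\<gamma> * (real N)\<^sup>2 * pi\<^sup>2) * (SUP s\<in>{0..t}. ereal \<bar>xi s\<bar>)"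
      unfolding S_def[symmetric]
    proof (rule reduce)
      show "0 < \<gamma> * (real N)\<^sup>2 * pi\<^sup>2" using \<gamma>0 assms(1) by simp
      fix \<Xi> assume "S = ereal \<Xi>"
      from bound[OF this, of "(Dx ^^ 2) (uh t) - (Dx ^^ 2) (u t)" "\<lambda>n. - lam n"
          "(Dx ^^ 2) uh0 - (Dx ^^ 2) u0" "(real N)\<^sup>2 * pi\<^sup>2"]
      show "norm ((Dx ^^ 2) (uh t) - (Dx ^^ 2) (u t))
          \<le> (real N)\<^sup>2 * pi\<^sup>2 * exp (- \<sigma> * t) * (K + 1 - 1) * norm (uh0 - u0)
            + exp (- \<sigma> * t) * norm ((Dx ^^ 2) uh0 - (Dx ^^ 2) u0) + \<gamma> * (real N)\<^sup>2 * pi\<^sup>2 * \<Xi>"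
        using lam_le by (simp add: coef_simps(2) coef_Dx_state_space(1) ss sst right_diff_distrib mult_ac)
    qed
    show "ereal (norm ((Dx ^^ 4) (uh t) - (Dx ^^ 4) (u t)))
        \<le> ereal ((real N) ^ 4 * pi ^ 4 * exp (- \<sigma> * t) * (K + 1 - 1) * norm (uh0 - u0)
            + exp (- \<sigma> * t) * norm ((Dx ^^ 4) uh0 - (Dx ^^ 4) u0))
          + ereal (\<gamma> * (real N) ^ 4 * pi ^ 4) * (SUP s\<in>{0..t}. ereal \<bar>xi s\<bar>)"
      unfolding S_def[symmetric]
    proof (rule reduce)
      show "0 < \<gamma> * (real N) ^ 4 * pi ^ 4" using \<gamma>0 assms(1) by simp
      fix \<Xi> assume "S = ereal \<Xi>"
      have "\<bar>(lam n)\<^sup>2\<bar> \<le> (real N) ^ 4 * pi ^ 4" if "n \<le> N" for n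
        using power_mono[OF lam_le(1,2)[OF that], of 2] by (simp add: power_mult_distrib flip: power_mult)
      from bound[OF \<open>S = ereal \<Xi>\<close>, of "(Dx ^^ 4) (uh t) - (Dx ^^ 4) (u t)" "\<lambda>n. (lam n)\<^sup>2"
          "(Dx ^^ 4) uh0 - (Dx ^^ 4) u0", OF _ _ this]
      show "norm ((Dx ^^ 4) (uh t) - (Dx ^^ 4) (u t))
          \<le> (real N) ^ 4 * pi ^ 4 * exp (- \<sigma> * t) * (K + 1 - 1) * norm (uh0 - u0)
            + exp (- \<sigma> * t) * norm ((Dx ^^ 4) uh0 - (Dx ^^ 4) u0) + \<gamma> * (real N) ^ 4 * pi ^ 4 * \<Xi>"
        by (simp add: coef_simps(2) coef_Dx_state_space(2) ss sst right_diff_distrib mult_ac)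
    qed
  qed
qed

end
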